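(* Let $G$ be a group that acts freely, isometrically and properly discontinuously on the unit sphere of $\mathbb{R}^n$ for some $n\geq 1$, or on the unit sphere of $l_2$. Then for every infinite dimensional real Hilbert space $\mathbb{H}$ the group $G$ acts freely, isometrically and properly discontinuously on the unit sphere of $\mathbb{H}$.
   Context: $l_2$ is the separable infinite dimensional real Hilbert space of square-summable real sequences. The unit sphere of a Hilbert space carries the Riemannian metric induced from the Hilbert space. "$G$ acts on a space with given properties" means there exists an action of $G$ with these properties; the action is isometric if every element acts as an isometry. A group $G$ acts properly discontinuously on a topological space $X$ if: (1) whenever $x,y\in X$ and $y\notin Gx$, there are neighborhoods $U$ of $x$ and $V$ of $y$ such that $gU\cap V=\emptyset$ for every $g\in G$; (2) for every $x\in X$ the stabilizer $G_x=\{g\in G: gx=x\}$ is finite; (3) every $x\in X$ has a neighborhood $U$, stable under $G_x$, such that $gU\cap U=\emptyset$ for every $g\in G\setminus G_x$. The action is free if $G_x=\{e\}$ for every $x\in X$. *)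

theory Defs
  imports "HOL-Analysis.Analysis" "HOL-Algebra.Group_Action"
begin

section \<open>The Hilbert space of square-summable real sequences\<close>

typedef l2 = "{x :: nat \<Rightarrow> real. summable (\<lambda>n. (x n)\<^sup>2)}"
  morphisms l2_nth Abs_l2
  by (rule exI[of _ "\<lambda>_. 0"]) simp

setup_lifting type_definition_l2

lemma summable_l2_nth: "summable (\<lambda>n. (l2_nth x n)\<^sup>2)"
  using l2_nth[of x] by simp

lemma l2_eqI: "(\<And>n. l2_nth x n = l2_nth y n) \<Longrightarrow> x = y"
  by (metis ext l2_nth_inject)

lemma summable_mult_of_squares:
  fixes x y :: "nat \<Rightarrow> real"
  assumes "summable (\<lambda>n. (x n)\<^sup>2)" "summable (\<lambda>n. (y n)\<^sup>2)"
  shows "summable (\<lambda>n. x n * y n)"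
proof (rule summable_comparison_test')
  show "summable (\<lambda>n. (x n)\<^sup>2 + (y n)\<^sup>2)"
    using assms by (rule summable_add)
  fix n :: nat
  have "2 * \<bar>x n * y n\<bar> \<le> (x n)\<^sup>2 + (y n)\<^sup>2"
    using zero_le_power2[of "\<bar>x n\<bar> - \<bar>y n\<bar>"] by (simp add: power2_diff abs_mult)
  then show "norm (x n * y n) \<le> (x n)\<^sup>2 + (y n)\<^sup>2"
    by simp
qed

instantiation l2 :: real_vector
begin

lift_definition zero_l2 :: l2 is "\<lambda>_. 0"
  by simp

lift_definition uminus_l2 :: "l2 \<Rightarrow> l2" is "\<lambda>x n. - x n"
  by simp

lift_definition plus_l2 :: "l2 \<Rightarrow> l2 \<Rightarrow> l2" is "\<lambda>x y n. x n + y n"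
  by (simp add: power2_sum mult.assoc summable_add summable_mult summable_mult_of_squares)

lift_definition minus_l2 :: "l2 \<Rightarrow> l2 \<Rightarrow> l2" is "\<lambda>x y n. x n - y n"
  by (simp add: power2_diff mult.assoc summable_add summable_diff summable_mult
      summable_mult_of_squares)

lift_definition scaleR_l2 :: "real \<Rightarrow> l2 \<Rightarrow> l2" is "\<lambda>c x n. c * x n"
  by (simp add: power_mult_distrib summable_mult)

instance
  by standard (transfer; simp add: algebra_simps fun_eq_iff)+

end

instantiation l2 :: real_inner
begin

lift_definition inner_l2 :: "l2 \<Rightarrow> l2 \<Rightarrow> real" is "\<lambda>x y. \<Sum>n. x n * y n" .

definition norm_l2 :: "l2 \<Rightarrow> real" where "norm_l2 x = sqrt (inner x x)"

definition sgn_l2 :: "l2 \<Rightarrow> l2" where "sgn_l2 x = x /\<^sub>R norm x"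

definition dist_l2 :: "l2 \<Rightarrow> l2 \<Rightarrow> real" where "dist_l2 x y = norm (x - y)"

definition uniformity_l2 :: "(l2 \<times> l2) filter"
  where "uniformity_l2 = (INF e\<in>{0<..}. principal {(x, y). dist x y < e})"

definition open_l2 :: "l2 set \<Rightarrow> bool"
  where "open_l2 U \<longleftrightarrow> (\<forall>x\<in>U. eventually (\<lambda>(x', y). x' = x \<longrightarrow> y \<in> U) uniformity)"

instance
proof
  fix x y z :: l2 and r :: real and U :: "l2 set"
  show "sgn x = x /\<^sub>R norm x" by (rule sgn_l2_def)
  show "dist x y = norm (x - y)" by (rule dist_l2_def)
  show "uniformity = (INF e\<in>{0<..}. principal {(x, y). dist (x::l2) y < e})"
    by (rule uniformity_l2_def)
  show "open U \<longleftrightarrow> (\<forall>x\<in>U. eventually (\<lambda>(x', y). x' = x \<longrightarrow> y \<in> U) uniformity)"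
    by (rule open_l2_def)
  show "inner x y = inner y x"
    by transfer (simp add: mult.commute)
  show "inner (x + y) z = inner x z + inner y z"
    by transfer (simp add: distrib_right suminf_add summable_mult_of_squares)
  show "inner (r *\<^sub>R x) y = r * inner x y"
    by transfer (simp add: mult.assoc suminf_mult summable_mult_of_squares)
  show "0 \<le> inner x x"
    by transfer (simp add: suminf_nonneg power2_eq_square)
  show "inner x x = 0 \<longleftrightarrow> x = 0"
    by transfer (simp add: suminf_eq_zero_iff power2_eq_square fun_eq_iff)
  show "norm x = sqrt (inner x x)" by (rule norm_l2_def)
qed

end

lemma norm_l2_power2: "(norm x)\<^sup>2 = (\<Sum>n. (l2_nth x n)\<^sup>2)" for x :: l2
  by (simp add: power2_norm_eq_inner inner_l2.rep_eq flip: power2_eq_square)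

lemma sum_l2_le_norm: "(\<Sum>n<K. (l2_nth x n)\<^sup>2) \<le> (norm x)\<^sup>2"
  unfolding norm_l2_power2 by (rule sum_le_suminf) (auto simp: summable_l2_nth)

lemma abs_l2_nth_le_norm: "\<bar>l2_nth x n\<bar> \<le> norm x"
proof -
  have "(l2_nth x n)\<^sup>2 \<le> (\<Sum>i<Suc n. (l2_nth x i)\<^sup>2)"
    by (simp add: sum_nonneg)
  also have "\<dots> \<le> (norm x)\<^sup>2"
    by (rule sum_l2_le_norm)
  finally show ?thesis
    by (simp flip: abs_le_square_iff[of _ "norm x", simplified])
qed

instance l2 :: complete_space
proof
  fix X :: "nat \<Rightarrow> l2"
  assume X: "Cauchy X"
  have "convergent (\<lambda>k. l2_nth (X k) n)" for n
  proof (rule Cauchy_convergent, rule metric_CauchyI)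
    fix e :: real
    assume "0 < e"
    then obtain M where M: "\<And>j k. j \<ge> M \<Longrightarrow> k \<ge> M \<Longrightarrow> dist (X j) (X k) < e"
      using metric_CauchyD[OF X] by blast
    have "dist (l2_nth (X j) n) (l2_nth (X k) n) < e" if "j \<ge> M" "k \<ge> M" for j k
      using abs_l2_nth_le_norm[of "X j - X k" n] M[OF that]
      by (simp add: dist_norm minus_l2.rep_eq)
    then show "\<exists>M. \<forall>j\<ge>M. \<forall>k\<ge>M. dist (l2_nth (X j) n) (l2_nth (X k) n) < e"
      by blast
  qed
  then obtain x where x: "\<And>n. (\<lambda>k. l2_nth (X k) n) \<longlonglongrightarrow> x n"
    unfolding convergent_def by metis
  have bound: "(\<Sum>n<K. (l2_nth (X j) n - x n)\<^sup>2) \<le> e\<^sup>2"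
    if M: "\<And>j k. j \<ge> M \<Longrightarrow> k \<ge> M \<Longrightarrow> dist (X j) (X k) < e" and j: "j \<ge> M" for e M j K
  proof (rule tendsto_upperbound)
    show "(\<lambda>k. \<Sum>n<K. (l2_nth (X j) n - l2_nth (X k) n)\<^sup>2)
            \<longlonglongrightarrow> (\<Sum>n<K. (l2_nth (X j) n - x n)\<^sup>2)"
      by (intro tendsto_intros x)
    show "\<forall>\<^sub>F k in sequentially. (\<Sum>n<K. (l2_nth (X j) n - l2_nth (X k) n)\<^sup>2) \<le> e\<^sup>2"
    proof (rule eventually_sequentiallyI)
      fix k
      assume "k \<ge> M"
      then have "norm (X j - X k) \<le> e"
        using M[OF j] by (simp add: dist_norm less_imp_le)
      then have "(norm (X j - X k))\<^sup>2 \<le> e\<^sup>2"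
        by (rule power_mono) simp
      with sum_l2_le_norm[of "X j - X k" K]
      show "(\<Sum>n<K. (l2_nth (X j) n - l2_nth (X k) n)\<^sup>2) \<le> e\<^sup>2"
        by (simp add: minus_l2.rep_eq)
    qed
  qed simp
  have diff: "summable (\<lambda>n. (l2_nth (X j) n - x n)\<^sup>2)"
    if M: "\<And>j k. j \<ge> M \<Longrightarrow> k \<ge> M \<Longrightarrow> dist (X j) (X k) < e" and j: "j \<ge> M" for e M j
    by (rule bounded_imp_summable[of _ "e\<^sup>2"])
      (simp, unfold lessThan_Suc_atMost[symmetric], rule bound[OF M j])
  obtain M where M: "\<And>j k. j \<ge> M \<Longrightarrow> k \<ge> M \<Longrightarrow> dist (X j) (X k) < 1"
    using metric_CauchyD[OF X, of 1] by auto
  have d: "(\<lambda>n. l2_nth (X M) n - x n) \<in> {x. summable (\<lambda>n. (x n)\<^sup>2)}"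
    using diff[OF M order_refl] by simp
  define L where "L = X M - Abs_l2 (\<lambda>n. l2_nth (X M) n - x n)"
  have L: "l2_nth L n = x n" for n
    unfolding L_def minus_l2.rep_eq Abs_l2_inverse[OF d] by simp
  have "X \<longlonglongrightarrow> L"
  proof (rule metric_LIMSEQ_I)
    fix r :: real
    assume r: "0 < r"
    then obtain M where M: "\<And>j k. j \<ge> M \<Longrightarrow> k \<ge> M \<Longrightarrow> dist (X j) (X k) < r / 2"
      using metric_CauchyD[OF X, of "r / 2"] by auto
    have "dist (X j) L < r" if j: "j \<ge> M" for j
    proof -
      have "(norm (X j - L))\<^sup>2 = (\<Sum>n. (l2_nth (X j) n - x n)\<^sup>2)"
        by (simp add: norm_l2_power2 minus_l2.rep_eq L)
      also have "\<dots> \<le> (r / 2)\<^sup>2"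
        by (rule suminf_le_const) (use diff[OF M j] bound[OF M j] in simp_all)
      finally have "norm (X j - L) \<le> r / 2"
        by (rule power2_le_imp_le) (use r in simp)
      then show ?thesis
        using r by (simp add: dist_norm)
    qed
    then show "\<exists>no. \<forall>n\<ge>no. dist (X n) L < r"
      by blast
  qed
  then show "convergent X"
    by (rule convergentI)
qed


section \<open>The Riemannian distance\<close>

text \<open>
  The length is taken as a nonnegative Lebesgue integral with values in \<^typ>\<open>ennreal\<close>, so that a
  curve whose speed is not integrable has infinite length. The finitely many points of the unit
  interval at which a piecewise continuously differentiable curve may fail to be differentiable
  do not affect the integral.
\<close>

definition curve_length :: "(real \<Rightarrow> 'a :: real_normed_vector) \<Rightarrow> ennreal" where
  "curve_length \<gamma> =
     (\<integral>\<^sup>+ t\<in>{0..1}. ennreal (norm (vector_derivative \<gamma> (at t))) \<partial>lborel)"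

text \<open>
  The metric tensor induced on a submanifold \<open>S\<close> is the restriction of the ambient inner product,
  so the length of a curve in \<open>S\<close> is its length in the ambient space. Points that no such curve
  in \<open>S\<close> joins, as the two points of the unit sphere of a one-dimensional space, have
  distance \<open>\<infinity>\<close>.
\<close>

definition riemannian_dist :: "'a :: real_inner set \<Rightarrow> 'a \<Rightarrow> 'a \<Rightarrow> ennreal" where
  "riemannian_dist S x y =
     (INF \<gamma> \<in> {\<gamma>. valid_path \<gamma> \<and> path_image \<gamma> \<subseteq> S \<and> pathstart \<gamma> = x \<and> pathfinish \<gamma> = y}.
        curve_length \<gamma>)"


section \<open>Properties of group actions\<close>

definition isometric_action ::
    "('g, 'm) monoid_scheme \<Rightarrow> 'a :: real_inner set \<Rightarrow> ('g \<Rightarrow> 'a \<Rightarrow> 'a) \<Rightarrow> bool" where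
  "isometric_action G S \<phi> \<longleftrightarrow>
     (\<forall>g \<in> carrier G. \<forall>x \<in> S. \<forall>y \<in> S.
        riemannian_dist S (\<phi> g x) (\<phi> g y) = riemannian_dist S x y)"

definition free_action ::
    "('g, 'm) monoid_scheme \<Rightarrow> 'x set \<Rightarrow> ('g \<Rightarrow> 'x \<Rightarrow> 'x) \<Rightarrow> bool" where
  "free_action G E \<phi> \<longleftrightarrow> (\<forall>x \<in> E. stabilizer G \<phi> x = {\<one>\<^bsub>G\<^esub>})"

definition neighborhood :: "'x topology \<Rightarrow> 'x \<Rightarrow> 'x set \<Rightarrow> bool" where
  "neighborhood X x U \<longleftrightarrow> U \<subseteq> topspace X \<and> (\<exists>W. openin X W \<and> x \<in> W \<and> W \<subseteq> U)"

definition properly_discontinuous_action ::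
    "('g, 'm) monoid_scheme \<Rightarrow> 'x topology \<Rightarrow> ('g \<Rightarrow> 'x \<Rightarrow> 'x) \<Rightarrow> bool" where
  "properly_discontinuous_action G X \<phi> \<longleftrightarrow>
     (\<forall>x \<in> topspace X. \<forall>y \<in> topspace X. y \<notin> orbit G \<phi> x \<longrightarrow>
        (\<exists>U V. neighborhood X x U \<and> neighborhood X y V \<and>
           (\<forall>g \<in> carrier G. \<phi> g ` U \<inter> V = {}))) \<and>
     (\<forall>x \<in> topspace X. finite (stabilizer G \<phi> x)) \<and>
     (\<forall>x \<in> topspace X. \<exists>U. neighborhood X x U \<and>
        (\<forall>g \<in> stabilizer G \<phi> x. \<phi> g ` U = U) \<and>
        (\<forall>g \<in> carrier G - stabilizer G \<phi> x. \<phi> g ` U \<inter> U = {}))"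

text \<open>
  The subspace topology on the unit sphere is also the topology of its Riemannian distance.
\<close>

definition acts_freely_isometrically_prop_disc ::
    "('g, 'm) monoid_scheme \<Rightarrow> 'a :: real_inner set \<Rightarrow> bool" where
  "acts_freely_isometrically_prop_disc G S \<longleftrightarrow>
     (\<exists>\<phi>. group_action G S \<phi> \<and> free_action G S \<phi> \<and> isometric_action G S \<phi> \<and>
        properly_discontinuous_action G (top_of_set S) \<phi>)"

end

theory Submission
  imports Defs
begin

text \<open>
  The action on the sphere of the small space is linear, and a linear action can be copied into every
  summand of an orthogonal decomposition of the large space.

  Let \<open>K\<close> be \<open>real ^ 'n\<close> or \<open>l2\<close>. On the unit sphere of a real inner product space the Riemannian distance of \<open>x\<close>
  and \<open>y\<close> is \<open>arccos (x \<bullet> y)\<close> unless \<open>y = - x\<close>, and then it is at least \<open>pi\<close>. It therefore determines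
  \<open>x \<bullet> y\<close> (lemma \<open>inner_eq_if_riemannian_dist_eq\<close>), so an isometry of the sphere preserves inner products and
  extends to a linear one. Thus an action as in the hypothesis is the restriction of an orthogonal
  representation \<open>\<rho>\<close> on \<open>K\<close> (lemma \<open>orthogonal_rep_of_sphere_action\<close>). Freeness and proper discontinuity
  become metric statements: a nonzero vector is moved by at least some \<open>\<delta> > 0\<close> by all nontrivial
  group elements, and a vector outside an orbit has positive distance from it.

  An infinite-dimensional Hilbert space \<open>H\<close> has an infinite orthonormal basis \<open>B\<close>, and \<open>B\<close> is in bijection with
  \<open>B \<times> N\<close> for every countable nonempty \<open>N\<close>. Taking for \<open>N\<close> the index set of the standard coordinates of \<open>K\<close>
  and grouping basis vectors accordingly makes \<open>H\<close> a Hilbert sum of copies of \<open>K\<close>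
  (lemma \<open>hilbert_sum_regroup\<close>). Letting \<open>G\<close> act by \<open>\<rho>\<close> in each copy gives an orthogonal
  representation on \<open>H\<close>. The two metric statements hold for it because they can be tested on
  one nonzero coordinate (lemma \<open>free_discrete_orthogonal_rep_sum\<close>), and linear isometries
  preserve the Riemannian distance of the sphere. Restriction to the sphere of \<open>H\<close> gives the action
  (lemma \<open>acts_on_sphere\<close>).
\<close>

section \<open>Curve length and norm-preserving maps\<close>

lemma valid_path_derivative:
  assumes "valid_path \<gamma>"
  obtains S where "finite S"
    and "\<And>t. t \<in> {0..1} - S \<Longrightarrow> (\<gamma> has_vector_derivative vector_derivative \<gamma> (at t)) (at t)"
    and "continuous_on ({0..1} - S) (\<lambda>t. vector_derivative \<gamma> (at t))"
  using assms unfolding valid_path_def piecewise_C1_differentiable_on_def C1_differentiable_on_eq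
  by (metis vector_derivative_works)

lemma AE_not_in_finite_lborel: "finite S \<Longrightarrow> AE t in lborel. t \<notin> (S :: real set)"
  by (rule AE_not_in) (rule finite_imp_null_set_lborel)

lemma norm_preserving_bounded_linear:
  assumes "linear f" "\<And>x. norm (f x) = norm x"
  shows "bounded_linear f"
  using assms by (intro bounded_linear_intro[where K = 1]) (auto simp: linear_add linear_scale)

text \<open>
  The two length integrands agree away from the finitely many break points of \<open>\<gamma>\<close>. At a break point
  the vector derivative is an arbitrary value, so they may differ there, but finite sets are null.
\<close>
lemma norm_preserving_image_path:
  fixes f :: "'a :: real_inner \<Rightarrow> 'b :: real_inner"
  assumes f: "linear f" "\<And>x. norm (f x) = norm x" and \<gamma>: "valid_path \<gamma>"
  shows "valid_path (f \<circ> \<gamma>)" "curve_length (f \<circ> \<gamma>) = curve_length \<gamma>"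
proof -
  interpret bounded_linear f
    by (rule norm_preserving_bounded_linear[OF f])
  obtain S where S: "finite S"
    and D: "\<And>t. t \<in> {0..1} - S \<Longrightarrow> (\<gamma> has_vector_derivative vector_derivative \<gamma> (at t)) (at t)"
    and C: "continuous_on ({0..1} - S) (\<lambda>t. vector_derivative \<gamma> (at t))"
    by (rule valid_path_derivative[OF \<gamma>]) (rule that)
  have fD: "(f \<circ> \<gamma> has_vector_derivative f (vector_derivative \<gamma> (at t))) (at t)"
    if "t \<in> {0..1} - S" for t
    using has_vector_derivative[OF D[OF that]] by (simp add: o_def)
  have "f \<circ> \<gamma> C1_differentiable_on {0..1} - S"
    unfolding C1_differentiable_on_def
    by (intro exI[of _ "\<lambda>t. f (vector_derivative \<gamma> (at t))"] conjI ballI fD continuous_on[OF C])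
  moreover have "continuous_on {0..1} (f \<circ> \<gamma>)"
    using continuous_on[of "{0..1}" \<gamma>] valid_path_imp_path[OF \<gamma>] by (simp add: path_def o_def)
  ultimately show "valid_path (f \<circ> \<gamma>)"
    unfolding valid_path_def piecewise_C1_differentiable_on_def using S by blast
  show "curve_length (f \<circ> \<gamma>) = curve_length \<gamma>"
    unfolding curve_length_def
  proof (rule nn_integral_cong_AE)
    show "AE t in lborel. ennreal (norm (vector_derivative (f \<circ> \<gamma>) (at t))) * indicator {0..1} t =
       ennreal (norm (vector_derivative \<gamma> (at t))) * indicator {0..1} t"
      using AE_not_in_finite_lborel[OF S]
    proof eventually_elim
      case (elim t)
      then show ?case
        using vector_derivative_at[OF fD[of t]] f(2) by (simp add: indicator_def)
    qed
  qed
qed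

lemma riemannian_dist_image_le:
  fixes f :: "'a :: real_inner \<Rightarrow> 'b :: real_inner"
  assumes f: "linear f" "\<And>x. norm (f x) = norm x" and "f ` S \<subseteq> T"
  shows "riemannian_dist T (f x) (f y) \<le> riemannian_dist S x y"
  unfolding riemannian_dist_def
proof (rule INF_mono)
  fix \<gamma> :: "real \<Rightarrow> 'a"
  assume "\<gamma> \<in> {\<gamma>. valid_path \<gamma> \<and> path_image \<gamma> \<subseteq> S \<and> pathstart \<gamma> = x \<and> pathfinish \<gamma> = y}"
  then have "valid_path \<gamma>" "path_image \<gamma> \<subseteq> S" "pathstart \<gamma> = x" "pathfinish \<gamma> = y"
    by auto
  moreover from this \<open>f ` S \<subseteq> T\<close> have "f ` path_image \<gamma> \<subseteq> T"
    by blast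
  ultimately show "\<exists>\<delta> \<in> {\<gamma>. valid_path \<gamma> \<and> path_image \<gamma> \<subseteq> T \<and> pathstart \<gamma> = f x \<and> pathfinish \<gamma> = f y}.
          curve_length \<delta> \<le> curve_length \<gamma>"
    by (intro bexI[of _ "f \<circ> \<gamma>"])
      (auto simp: norm_preserving_image_path[OF f] path_image_compose pathstart_compose pathfinish_compose)
qed

section \<open>The Riemannian distance of the unit sphere\<close>

lemma abs_inner_le_1:
  fixes x y :: "'a :: real_inner"
  assumes "norm x = 1" "norm y = 1"
  shows "\<bar>x \<bullet> y\<bar> \<le> 1"
  using Cauchy_Schwarz_ineq2[of x y] assms by simp

text \<open>
  A real function whose speed is dominated by that of the curve increases by at most the length of
  the curve: this is the fundamental theorem of calculus. The derivative of a piecewise continuously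
  differentiable curve can be unbounded near a break point, so a finite length is what makes the
  speed integrable.
\<close>
lemma curve_length_ge_increment:
  fixes \<gamma> :: "real \<Rightarrow> 'a :: real_inner" and F D :: "real \<Rightarrow> real"
  assumes \<gamma>: "valid_path \<gamma>" and F: "continuous_on {0..1} F" and N: "finite N"
    and D: "\<And>t. t \<in> {0<..<1} - N \<Longrightarrow> (F has_vector_derivative D t) (at t)"
    and bound: "\<And>t. t \<in> {0<..<1} - N \<Longrightarrow> \<bar>D t\<bar> \<le> norm (vector_derivative \<gamma> (at t))"
  shows "ennreal \<bar>F 1 - F 0\<bar> \<le> curve_length \<gamma>"
proof -
  obtain S where S: "finite S"
    and C: "continuous_on ({0..1} - S) (\<lambda>t. vector_derivative \<gamma> (at t))"
    by (rule valid_path_derivative[OF \<gamma>]) (rule that)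
  define h where "h t = indicator ({0..1} - S) t *\<^sub>R norm (vector_derivative \<gamma> (at t))" for t
  have h: "h \<in> borel_measurable lborel"
    using borel_measurable_continuous_on_indicator[OF _ continuous_on_norm[OF C]] S
    by (simp add: h_def[abs_def] finite_imp_closed borel_closed sets.Diff)
  have h_nonneg: "h t \<ge> 0" for t
    by (simp add: h_def)
  have "curve_length \<gamma> = (\<integral>\<^sup>+ t. ennreal (h t) \<partial>lborel)"
    unfolding curve_length_def
  proof (rule nn_integral_cong_AE)
    show "AE t in lborel. ennreal (norm (vector_derivative \<gamma> (at t))) * indicator {0..1} t = ennreal (h t)"
      using AE_not_in_finite_lborel[OF S] by eventually_elim (simp add: h_def indicator_def)
  qed
  show ?thesis
  proof (cases "curve_length \<gamma> = \<infinity>")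
    case False
    then have int: "integrable lborel h"
      using h h_nonneg \<open>curve_length \<gamma> = _\<close> by (simp add: integrable_iff_bounded less_top)
    \<comment> \<open>\<open>D\<close> is set to zero where it is not controlled, so that the comparison with \<open>h\<close> holds on the
      whole line.\<close>
    define E where "E t = (if t \<in> {0<..<1} - (N \<union> S) then D t else 0)" for t
    have "(E has_integral (F 1 - F 0)) {0..1}"
      by (rule fundamental_theorem_of_calculus_interior_strong[of "N \<union> S"])
        (use N S F D in \<open>auto simp: E_def\<close>)
    moreover have "(\<lambda>t. if t \<in> {0..1} then E t else 0) = E"
      by (auto simp: E_def)
    ultimately have E: "(E has_integral (F 1 - F 0)) UNIV"
      using has_integral_restrict_UNIV[of "{0..1}" E] by simp
    have "norm (integral UNIV E) \<le> integral UNIV h"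
    proof (rule integral_norm_bound_integral)
      show "E integrable_on UNIV"
        using E by blast
      show "h integrable_on UNIV"
        using has_integral_integral_lborel[OF int] by blast
      show "norm (E t) \<le> h t" for t
        using bound[of t] h_nonneg[of t] by (auto simp: E_def h_def)
    qed
    moreover have "integral UNIV h = integral\<^sup>L lborel h"
      using has_integral_integral_lborel[OF int] by (rule integral_unique)
    moreover have "curve_length \<gamma> = ennreal (integral\<^sup>L lborel h)"
      unfolding \<open>curve_length \<gamma> = _\<close> using nn_integral_eq_integral[OF int] h_nonneg by simp
    ultimately show ?thesis
      using integral_unique[OF E] by (simp add: ennreal_leI)
  qed simp
qed

text \<open>
  Let \<open>u\<close> move on the unit sphere with velocity \<open>v\<close>. The expression on the left is the speed of
  \<open>arccos (r * (u \<bullet> x))\<close>. With \<open>c = u \<bullet> x\<close>, only the component of \<open>x\<close> orthogonal to \<open>u\<close> contributes to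
  \<open>v \<bullet> x\<close>, and its norm is \<open>sqrt (1 - c\<^sup>2)\<close>; moreover \<open>r\<^sup>2 * (1 - c\<^sup>2) \<le> 1 - (r * c)\<^sup>2\<close>.
\<close>
lemma abs_arccos_derivative_le:
  fixes u v x :: "'a :: real_inner"
  assumes u: "norm u = 1" and x: "norm x = 1" and v: "v \<bullet> u = 0" and r: "0 < r" "r < 1"
  shows "\<bar>inverse (- sqrt (1 - (r * (u \<bullet> x))\<^sup>2)) * (r * (v \<bullet> x))\<bar> \<le> norm v"
proof -
  define c where "c = u \<bullet> x"
  have c: "c\<^sup>2 \<le> 1"
    using abs_inner_le_1[OF u x] by (simp add: c_def abs_square_le_1)
  have "v \<bullet> x = v \<bullet> (x - c *\<^sub>R u)"
    using v by (simp add: inner_diff_right)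
  then have vx: "\<bar>v \<bullet> x\<bar> \<le> norm v * norm (x - c *\<^sub>R u)"
    using Cauchy_Schwarz_ineq2 by metis
  have "(norm (x - c *\<^sub>R u))\<^sup>2 = 1 - c\<^sup>2"
  proof -
    have "u \<bullet> u = 1" "x \<bullet> x = 1" "x \<bullet> u = c"
      using u x by (simp_all add: norm_eq_1 c_def inner_commute)
    then show ?thesis
      unfolding power2_norm_eq_inner
      by (simp add: inner_diff_left inner_diff_right c_def[symmetric] power2_eq_square)
  qed
  then have "r * norm (x - c *\<^sub>R u) = sqrt (r\<^sup>2 * (1 - c\<^sup>2))"
    using r by (simp add: real_sqrt_mult flip: \<open>(norm (x - c *\<^sub>R u))\<^sup>2 = 1 - c\<^sup>2\<close>)
  also have "\<dots> \<le> sqrt (1 - (r * c)\<^sup>2)"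
  proof -
    have "r\<^sup>2 \<le> 1"
      using r by (simp add: power_le_one)
    then show ?thesis
      by (simp add: power_mult_distrib algebra_simps)
  qed
  finally have *: "r * norm (x - c *\<^sub>R u) \<le> sqrt (1 - (r * c)\<^sup>2)" .
  have "(r * c)\<^sup>2 < 1"
  proof -
    have "r\<^sup>2 * c\<^sup>2 \<le> r\<^sup>2" using c by (simp add: mult_left_le)
    moreover have "r\<^sup>2 < 1" using r by (simp add: power_less_one_iff abs_square_less_1)
    ultimately show ?thesis by (simp add: power_mult_distrib)
  qed
  then have pos: "sqrt (1 - (r * c)\<^sup>2) > 0"
    by simp
  have "r * \<bar>v \<bullet> x\<bar> \<le> norm v * (r * norm (x - c *\<^sub>R u))"
    using mult_left_mono[OF vx, of r] r by (simp add: mult.left_commute)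
  also have "\<dots> \<le> norm v * sqrt (1 - (r * c)\<^sup>2)"
    using * by (simp add: mult_left_mono)
  finally show ?thesis
    using pos r unfolding c_def[symmetric] by (simp add: abs_mult divide_simps mult.commute)
qed

text \<open>
  The angle between \<open>\<gamma> t\<close> and the starting point grows no faster than arc length. The angle is not
  differentiable where the curve passes through the starting point or its antipode. The factor
  \<open>r < 1\<close> keeps the argument of \<open>arccos\<close> away from \<open>-1\<close> and \<open>1\<close>, which makes the function
  differentiable at every smooth point; the limit \<open>r \<rightarrow> 1\<close> then gives the claim.
\<close>
lemma arccos_le_curve_length:
  fixes \<gamma> :: "real \<Rightarrow> 'a :: real_inner"
  assumes \<gamma>: "valid_path \<gamma>" and sphere: "path_image \<gamma> \<subseteq> sphere 0 1"
  shows "ennreal (arccos (pathstart \<gamma> \<bullet> pathfinish \<gamma>)) \<le> curve_length \<gamma>"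
proof (cases "curve_length \<gamma> = \<infinity>")
  case False
  then obtain L where L: "0 \<le> L" "curve_length \<gamma> = ennreal L"
    by (cases "curve_length \<gamma>") auto
  define x where "x = pathstart \<gamma>"
  define c where "c t = \<gamma> t \<bullet> x" for t
  have unit: "norm (\<gamma> t) = 1" if "t \<in> {0..1}" for t
    using sphere that by (force simp: path_image_def)
  have x: "norm x = 1" "x = \<gamma> 0"
    using unit[of 0] by (auto simp: x_def pathstart_def)
  have c: "\<bar>c t\<bar> \<le> 1" if "t \<in> {0..1}" for t
    using abs_inner_le_1[OF unit[OF that] x(1)] by (simp add: c_def)
  have c0: "c 0 = 1"
    using x by (simp add: c_def norm_eq_1)
  obtain S where S: "finite S"
    and D: "\<And>t. t \<in> {0..1} - S \<Longrightarrow> (\<gamma> has_vector_derivative vector_derivative \<gamma> (at t)) (at t)"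
    by (rule valid_path_derivative[OF \<gamma>]) (rule that)
  have cont: "continuous_on {0..1} c"
    using valid_path_imp_path[OF \<gamma>] by (auto simp: c_def[abs_def] path_def intro!: continuous_intros)
  \<comment> \<open>The velocity is tangent to the sphere because \<open>\<gamma> t \<bullet> \<gamma> t\<close> is constant.\<close>
  have tangent: "vector_derivative \<gamma> (at t) \<bullet> \<gamma> t = 0" if t: "t \<in> {0<..<1} - S" for t
  proof -
    have "((\<lambda>t. \<gamma> t \<bullet> \<gamma> t) has_vector_derivative
        \<gamma> t \<bullet> vector_derivative \<gamma> (at t) + vector_derivative \<gamma> (at t) \<bullet> \<gamma> t) (at t)"
      by (rule bounded_bilinear.has_vector_derivative[OF bounded_bilinear_inner]; rule D) (use t in auto)
    moreover have "((\<lambda>t. \<gamma> t \<bullet> \<gamma> t) has_vector_derivative 0) (at t)"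
    proof (rule has_vector_derivative_transform_within_open[of _ _ _ "{0<..<1}"])
      show "((\<lambda>_. 1) has_vector_derivative 0) (at t)" by simp
    qed (use t unit in \<open>auto simp: norm_eq_1\<close>)
    ultimately have "\<gamma> t \<bullet> vector_derivative \<gamma> (at t) + vector_derivative \<gamma> (at t) \<bullet> \<gamma> t = 0"
      by (rule vector_derivative_unique_at)
    then show ?thesis
      by (simp add: inner_commute)
  qed
  have le: "\<bar>arccos (r * c 1) - arccos r\<bar> \<le> L" if r: "0 < r" "r < 1" for r
  proof -
    have rc: "\<bar>r * c t\<bar> < 1" if "t \<in> {0..1}" for t
    proof -
      have "\<bar>r * c t\<bar> \<le> r" using c[OF that] r by (simp add: abs_mult mult_left_le)
      then show ?thesis using r by linarith
    qed
    have "ennreal \<bar>arccos (r * c 1) - arccos (r * c 0)\<bar> \<le> curve_length \<gamma>"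
    proof (rule curve_length_ge_increment[OF \<gamma> _ S])
      show "continuous_on {0..1} (\<lambda>t. arccos (r * c t))"
        by (rule continuous_on_arccos) (use cont rc in \<open>fastforce intro!: continuous_intros simp: abs_less_iff\<close>)+
    next
      fix t
      assume t: "t \<in> {0<..<1} - S"
      have "(c has_vector_derivative vector_derivative \<gamma> (at t) \<bullet> x) (at t)"
        unfolding c_def[abs_def]
        by (rule bounded_linear.has_vector_derivative[OF bounded_linear_inner_left]) (use D t in auto)
      then have "(c has_real_derivative vector_derivative \<gamma> (at t) \<bullet> x) (at t)"
        by (simp add: has_real_derivative_iff_has_vector_derivative)
      then have "((\<lambda>t. arccos (r * c t)) has_real_derivative
          inverse (- sqrt (1 - (r * c t)\<^sup>2)) * (r * (vector_derivative \<gamma> (at t) \<bullet> x))) (at t)"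
        by (intro DERIV_arccos[THEN DERIV_chain2] DERIV_cmult) (use rc[of t] t in \<open>auto simp: abs_less_iff\<close>)
      then show "((\<lambda>t. arccos (r * c t)) has_vector_derivative
          inverse (- sqrt (1 - (r * c t)\<^sup>2)) * (r * (vector_derivative \<gamma> (at t) \<bullet> x))) (at t)"
        by (simp add: has_real_derivative_iff_has_vector_derivative)
      show "\<bar>inverse (- sqrt (1 - (r * c t)\<^sup>2)) * (r * (vector_derivative \<gamma> (at t) \<bullet> x))\<bar>
          \<le> norm (vector_derivative \<gamma> (at t))"
        unfolding c_def by (rule abs_arccos_derivative_le) (use unit[of t] tangent[OF t] x t r in auto)
    qed
    then show ?thesis
      using L by (simp add: c0)
  qed
  have "((\<lambda>r. \<bar>arccos (r * c 1) - arccos r\<bar>) \<longlongrightarrow> \<bar>arccos (1 * c 1) - arccos 1\<bar>) (at_left 1)"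
  proof -
    have cont_r: "continuous_on {0..1} (\<lambda>r. \<bar>arccos (r * c 1) - arccos r\<bar>)"
    proof (intro continuous_intros continuous_on_arccos)
      show "\<forall>r\<in>{0..1}. - 1 \<le> r * c 1 \<and> r * c 1 \<le> 1"
      proof
        fix r :: real assume "r \<in> {0..1}"
        then have "\<bar>r * c 1\<bar> \<le> 1"
          using c[of 1] by (simp add: abs_mult mult_le_one)
        then show "- 1 \<le> r * c 1 \<and> r * c 1 \<le> 1" by linarith
      qed
    qed auto
    have "((\<lambda>r. \<bar>arccos (r * c 1) - arccos r\<bar>) \<longlongrightarrow> \<bar>arccos (1 * c 1) - arccos 1\<bar>) (at 1 within {0..1})"
      using cont_r unfolding continuous_on_def by (rule bspec) simp
    then show ?thesis
      by (simp add: at_within_Icc_at_left)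
  qed
  then have "\<bar>arccos (1 * c 1) - arccos 1\<bar> \<le> L"
  proof (rule tendsto_upperbound)
    show "\<forall>\<^sub>F r in at_left 1. \<bar>arccos (r * c 1) - arccos r\<bar> \<le> L"
      using eventually_at_left_real[OF zero_less_one] by eventually_elim (auto intro: le)
  qed simp
  then show ?thesis
    using L by (simp add: c_def x_def pathfinish_def inner_commute ennreal_leI)
qed simp

lemma arccos_le_riemannian_dist:
  "ennreal (arccos (x \<bullet> y)) \<le> riemannian_dist (sphere (0 :: 'a :: real_inner) 1) x y"
  unfolding riemannian_dist_def
  by (rule INF_greatest) (use arccos_le_curve_length in blast)

lemma inner_eq_minus_one:
  fixes x y :: "'a :: real_inner"
  assumes "norm x = 1" "norm y = 1" "x \<bullet> y = -1"
  shows "y = - x"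
proof -
  have "(x + y) \<bullet> (x + y) = 0"
    using assms by (simp add: inner_add_left inner_add_right norm_eq_1 inner_commute)
  then show ?thesis
    by (simp add: add_eq_0_iff)
qed

text \<open>
  The arc of the great circle through \<open>x\<close> and \<open>y\<close> has length \<open>arccos (x \<bullet> y)\<close>. Antipodal points are
  excluded because in a one-dimensional space no curve in the sphere joins them.
\<close>
lemma riemannian_dist_le_arccos:
  fixes x y :: "'a :: real_inner"
  assumes x: "norm x = 1" and y: "norm y = 1" and "y \<noteq> - x"
  shows "riemannian_dist (sphere 0 1) x y \<le> ennreal (arccos (x \<bullet> y))"
proof -
  define c where "c = x \<bullet> y"
  define \<theta> where "\<theta> = arccos c"
  \<comment> \<open>\<open>e\<close> is the unit vector orthogonal to \<open>x\<close> in the plane of \<open>x\<close> and \<open>y\<close>. If \<open>y = x\<close> then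
    \<open>1 / sin \<theta> = 0\<close>, so \<open>e = 0\<close> and the arc below is constant.\<close>
  define e where "e = (1 / sin \<theta>) *\<^sub>R (y - c *\<^sub>R x)"
  have xx: "x \<bullet> x = 1" "y \<bullet> y = 1" "y \<bullet> x = c"
    using x y by (simp_all add: norm_eq_1 c_def inner_commute)
  have c: "\<bar>c\<bar> \<le> 1" "c \<noteq> -1"
    using abs_inner_le_1[OF x y] inner_eq_minus_one[OF x y] \<open>y \<noteq> - x\<close> by (auto simp: c_def)
  then have \<theta>: "0 \<le> \<theta>" "cos \<theta> = c" "(sin \<theta>)\<^sup>2 = 1 - c\<^sup>2"
    by (auto simp: \<theta>_def abs_le_iff arccos_lbound sin_squared_eq)
  have xe: "x \<bullet> e = 0"
    by (simp add: e_def inner_diff_right xx) (simp add: c_def)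
  have sin0: "\<theta> = 0 \<and> y = x" if "sin \<theta> = 0"
  proof -
    have "c = 1"
      using \<theta> c that by (auto simp: power2_eq_1_iff)
    moreover from this have "- y = - x"
      using inner_eq_minus_one[of x "- y"] x y by (simp add: c_def)
    ultimately show ?thesis
      by (simp add: \<theta>_def)
  qed
  have ee: "sin \<theta> \<noteq> 0 \<Longrightarrow> e \<bullet> e = 1"
  proof -
    assume s: "sin \<theta> \<noteq> 0"
    have "(y - c *\<^sub>R x) \<bullet> (y - c *\<^sub>R x) = (sin \<theta>)\<^sup>2"
      using xx unfolding \<theta>(3)
      by (simp add: inner_diff_left inner_diff_right c_def[symmetric] power2_eq_square)
    then show "e \<bullet> e = 1"
      using s by (simp add: e_def power2_eq_square)
  qed
  define \<gamma> where "\<gamma> t = cos (\<theta> * t) *\<^sub>R x + sin (\<theta> * t) *\<^sub>R e" for t :: real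
  define \<gamma>' where "\<gamma>' t = (- \<theta> * sin (\<theta> * t)) *\<^sub>R x + (\<theta> * cos (\<theta> * t)) *\<^sub>R e" for t :: real
  have D: "(\<gamma> has_vector_derivative \<gamma>' t) (at t)" for t
  proof -
    have "((\<lambda>t. cos (\<theta> * t)) has_real_derivative - \<theta> * sin (\<theta> * t)) (at t)"
      "((\<lambda>t. sin (\<theta> * t)) has_real_derivative \<theta> * cos (\<theta> * t)) (at t)"
      by (auto intro!: derivative_eq_intros)
    then have "(\<gamma> has_vector_derivative
        (cos (\<theta> * t) *\<^sub>R 0 + (- \<theta> * sin (\<theta> * t)) *\<^sub>R x) +
        (sin (\<theta> * t) *\<^sub>R 0 + (\<theta> * cos (\<theta> * t)) *\<^sub>R e)) (at t)"
      unfolding \<gamma>_def[abs_def]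
      by (intro has_vector_derivative_add has_vector_derivative_scaleR has_vector_derivative_const)
    then show ?thesis
      by (simp add: \<gamma>'_def)
  qed
  have "\<gamma> C1_differentiable_on {0..1}"
    unfolding C1_differentiable_on_def
    by (intro exI[of _ \<gamma>']) (use D in \<open>auto simp: \<gamma>'_def[abs_def] intro!: continuous_intros\<close>)
  then have "valid_path \<gamma>"
    by (simp add: valid_path_def C1_differentiable_imp_piecewise)
  moreover have "norm (\<gamma> t) = 1" for t
  proof (cases "sin \<theta> = 0")
    case True
    then show ?thesis using sin0 x by (simp add: \<gamma>_def)
  next
    case False
    then show ?thesis
      using ee xe by (simp add: norm_eq_1 \<gamma>_def inner_add_left inner_add_right xx inner_commute
          flip: power2_eq_square)
  qed
  moreover have "pathstart \<gamma> = x"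
    by (simp add: \<gamma>_def pathstart_def)
  moreover have "pathfinish \<gamma> = y"
    using sin0 by (cases "sin \<theta> = 0") (auto simp: \<gamma>_def pathfinish_def e_def \<theta>)
  ultimately have "riemannian_dist (sphere 0 1) x y \<le> curve_length \<gamma>"
    unfolding riemannian_dist_def by (intro INF_lower) (auto simp: path_image_def)
  also have "\<dots> = (\<integral>\<^sup>+ t\<in>{0..1}. ennreal (norm (\<gamma>' t)) \<partial>lborel)"
    by (simp add: curve_length_def vector_derivative_at[OF D])
  also have "\<dots> = (\<integral>\<^sup>+ t\<in>{0..1::real}. ennreal \<theta> \<partial>lborel)"
  proof -
    have "norm (\<gamma>' t) = \<theta>" for t
    proof (cases "sin \<theta> = 0")
      case True
      then show ?thesis using sin0 by (simp add: \<gamma>'_def)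
    next
      case False
      then have "\<gamma>' t \<bullet> \<gamma>' t = (\<theta> * sin (\<theta> * t))\<^sup>2 + (\<theta> * cos (\<theta> * t))\<^sup>2"
        using ee xe by (simp add: \<gamma>'_def inner_diff_left inner_diff_right xx inner_commute
            flip: power2_eq_square)
      also have "\<dots> = \<theta>\<^sup>2 * ((sin (\<theta> * t))\<^sup>2 + (cos (\<theta> * t))\<^sup>2)"
        by (simp only: power_mult_distrib distrib_left)
      finally show ?thesis
        using \<theta> by (simp add: norm_eq_sqrt_inner)
    qed
    then show ?thesis by simp
  qed
  also have "\<dots> = ennreal \<theta>"
    by (simp add: nn_integral_cmult_indicator)
  finally show ?thesis
    by (simp add: \<theta>_def c_def)
qed

text \<open>
  For points that are not antipodal the distance is \<open>arccos (x \<bullet> y) < pi\<close>, and for antipodal points it is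
  at least \<open>pi\<close>. Hence the distance determines the inner product, in every dimension.
\<close>
lemma inner_eq_if_riemannian_dist_eq:
  fixes x y x' y' :: "'a :: real_inner"
  assumes unit: "norm x = 1" "norm y = 1" "norm x' = 1" "norm y' = 1"
    and eq: "riemannian_dist (sphere 0 1) x y = riemannian_dist (sphere 0 1) x' y'"
  shows "x \<bullet> y = x' \<bullet> y'"
proof -
  have le: "x' \<bullet> y' \<le> x \<bullet> y"
    if unit: "norm x = 1" "norm y = 1" "norm x' = 1" "norm y' = 1"
      and eq: "riemannian_dist (sphere 0 1) x y = riemannian_dist (sphere 0 1) x' y'"
    for x y x' y' :: 'a
  proof (cases "y' = - x'")
    case True
    then have "x' \<bullet> y' = -1"
      using unit by (simp add: norm_eq_1)
    then show ?thesis
      using abs_inner_le_1[OF unit(1,2)] by linarith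
  next
    case False
    have "ennreal (arccos (x \<bullet> y)) \<le> ennreal (arccos (x' \<bullet> y'))"
      using arccos_le_riemannian_dist[of x y] riemannian_dist_le_arccos[OF unit(3,4) False] eq by simp
    then have "arccos (x \<bullet> y) \<le> arccos (x' \<bullet> y')"
      using abs_inner_le_1[OF unit(3,4)] by (simp add: abs_le_iff arccos_lbound)
    then show ?thesis
      using abs_inner_le_1[OF unit(1,2)] abs_inner_le_1[OF unit(3,4)] by (simp add: arccos_le_mono)
  qed
  show ?thesis
    using le[OF unit eq] le[OF unit(3,4,1,2) eq[symmetric]] by simp
qed

section \<open>Free actions on spheres as orthogonal representations\<close>

text \<open>
  The squared norm of \<open>f (x + y) - (f x + f y)\<close> expands into inner products of values of \<open>f\<close>, and it
  vanishes because the same expression with \<open>f\<close> removed does; likewise for scalar multiples.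
\<close>
lemma orthogonal_transformation_if_inner_preserving:
  fixes f :: "'a :: real_inner \<Rightarrow> 'a"
  assumes f: "\<And>x y. f x \<bullet> f y = x \<bullet> y"
  shows "orthogonal_transformation f"
proof -
  have "f (x + y) = f x + f y" for x y
  proof -
    have "(f (x + y) - (f x + f y)) \<bullet> (f (x + y) - (f x + f y)) = 0"
      by (simp add: inner_diff_left inner_diff_right inner_add_left inner_add_right f)
    then show ?thesis by simp
  qed
  moreover have "f (c *\<^sub>R x) = c *\<^sub>R f x" for c x
  proof -
    have "(f (c *\<^sub>R x) - c *\<^sub>R f x) \<bullet> (f (c *\<^sub>R x) - c *\<^sub>R f x) = 0"
      by (simp add: inner_diff_left inner_diff_right f)
    then show ?thesis by simp
  qed
  ultimately show ?thesis
    using f by (simp add: orthogonal_transformation_def linearI)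
qed

text \<open>
  The linear form of a free and properly discontinuous isometric action on a sphere. Since every
  \<open>\<rho> g\<close> is an isometry, proper discontinuity and freeness amount to two metric conditions on orbits:
  the nontrivial group elements move a nonzero vector by a distance bounded below, and
  a vector outside an orbit has positive distance from that orbit. In this form they pass to orthogonal sums.
\<close>
locale free_discrete_orthogonal_rep = group G for G (structure) +
  fixes \<rho> :: "'g \<Rightarrow> 'a :: real_inner \<Rightarrow> 'a"
  assumes orthogonal: "g \<in> carrier G \<Longrightarrow> orthogonal_transformation (\<rho> g)"
    and mult: "g \<in> carrier G \<Longrightarrow> h \<in> carrier G \<Longrightarrow> \<rho> (g \<otimes> h) v = \<rho> g (\<rho> h v)"
    and one: "\<rho> \<one> v = v"
    and displacement:
      "v \<noteq> 0 \<Longrightarrow> \<exists>\<delta>>0. \<forall>g \<in> carrier G - {\<one>}. \<delta> \<le> dist (\<rho> g v) v"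
    and separation:
      "(\<And>g. g \<in> carrier G \<Longrightarrow> \<rho> g v \<noteq> w) \<Longrightarrow> \<exists>\<delta>>0. \<forall>g \<in> carrier G. \<delta> \<le> dist (\<rho> g v) w"
begin

lemma linear_rep: "g \<in> carrier G \<Longrightarrow> linear (\<rho> g)"
  using orthogonal orthogonal_transformation_linear by blast

lemma norm_rep [simp]: "g \<in> carrier G \<Longrightarrow> norm (\<rho> g v) = norm v"
  using orthogonal orthogonal_transformation_norm by blast

lemma dist_rep [simp]: "g \<in> carrier G \<Longrightarrow> dist (\<rho> g v) (\<rho> g w) = dist v w"
  by (metis dist_norm linear_diff linear_rep norm_rep)

lemma inv_rep [simp]: "g \<in> carrier G \<Longrightarrow> \<rho> (inv g) (\<rho> g v) = v" "g \<in> carrier G \<Longrightarrow> \<rho> g (\<rho> (inv g) v) = v"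
  by (simp_all flip: mult add: one)

lemma moves_nonzero:
  assumes "v \<noteq> 0" "g \<in> carrier G" "\<rho> g v = v"
  shows "g = \<one>"
  using displacement[OF assms(1)] assms(2,3) by force

end

lemma neighborhood_sphere_ball:
  assumes "neighborhood (top_of_set (sphere (0 :: 'a :: real_inner) 1)) x U"
  obtains \<epsilon> where "0 < \<epsilon>" "\<And>y. norm y = 1 \<Longrightarrow> dist y x < \<epsilon> \<Longrightarrow> y \<in> U"
  using assms unfolding neighborhood_def openin_euclidean_subtopology_iff
  by (metis mem_sphere_0 subsetD)

lemma neighborhood_mem: "neighborhood X x U \<Longrightarrow> x \<in> U"
  by (auto simp: neighborhood_def)

lemma ball_neighborhood_sphere:
  assumes "norm x = 1" "0 < \<epsilon>"
  shows "neighborhood (top_of_set (sphere (0 :: 'a :: real_inner) 1)) x (sphere 0 1 \<inter> ball x \<epsilon>)"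
  unfolding neighborhood_def using assms by (auto intro!: exI[of _ "sphere 0 1 \<inter> ball x \<epsilon>"])

text \<open>
  An isometric action on the unit sphere preserves inner products, by
  \<open>inner_eq_if_riemannian_dist_eq\<close>. Its extension \<open>norm v *\<^sub>R \<phi> g (v / norm v)\<close>, homogeneous of
  degree one, then preserves all inner products and is therefore linear. Vectors of different norm
  are separated by the difference of their norms, so both metric conditions reduce to unit vectors.
\<close>
lemma orthogonal_rep_of_sphere_action:
  fixes G :: "('g, 'm) monoid_scheme"
  assumes "group G" and acts: "acts_freely_isometrically_prop_disc G (sphere (0 :: 'a :: real_inner) 1)"
  shows "\<exists>\<rho> :: 'g \<Rightarrow> 'a \<Rightarrow> 'a. free_discrete_orthogonal_rep G \<rho>"
proof -
  let ?S = "sphere (0 :: 'a) 1"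
  from acts obtain \<phi> where act: "group_action G ?S \<phi>" and free: "free_action G ?S \<phi>"
    and iso: "isometric_action G ?S \<phi>"
    and pd: "properly_discontinuous_action G (top_of_set ?S) \<phi>"
    unfolding acts_freely_isometrically_prop_disc_def by blast
  interpret group G by fact
  interpret group_action G ?S \<phi> by fact
  have unit: "norm (\<phi> g x) = 1" if "g \<in> carrier G" "norm x = 1" for g x
    using element_image[OF that(1), of x "\<phi> g x"] that(2) by simp
  have inner: "\<phi> g x \<bullet> \<phi> g y = x \<bullet> y" if "g \<in> carrier G" "norm x = 1" "norm y = 1" for g x y
    using that iso by (intro inner_eq_if_riemannian_dist_eq unit) (auto simp: isometric_action_def)
  define \<rho> where "\<rho> g v = norm v *\<^sub>R \<phi> g (sgn v)" for g v
  have sgn_unit: "norm (sgn v) = 1" if "v \<noteq> 0" for v :: 'a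
    using that by (simp add: norm_sgn)
  have scale_sgn: "norm v *\<^sub>R sgn v = v" for v :: 'a
    by (cases "v = 0") (simp_all add: sgn_div_norm)
  have norm_\<rho>: "norm (\<rho> g v) = norm v" if "g \<in> carrier G" for g v
    using unit[OF that sgn_unit[of v]] by (cases "v = 0") (auto simp: \<rho>_def)
  have sgn_\<rho>: "sgn (\<rho> g v) = \<phi> g (sgn v)" if "g \<in> carrier G" "v \<noteq> 0" for g v
    using unit[OF that(1) sgn_unit[OF that(2)]] that by (simp add: \<rho>_def sgn_div_norm)
  have dist_scale: "dist (\<rho> g v) (norm v *\<^sub>R w) = norm v * dist (\<phi> g (sgn v)) w" for g v w
    unfolding \<rho>_def by (metis abs_norm_cancel dist_norm norm_scaleR scaleR_diff_right)
  have "free_discrete_orthogonal_rep G \<rho>"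
  proof
    fix g
    assume g: "g \<in> carrier G"
    show "orthogonal_transformation (\<rho> g)"
    proof (rule orthogonal_transformation_if_inner_preserving)
      fix v w :: 'a
      show "\<rho> g v \<bullet> \<rho> g w = v \<bullet> w"
      proof (cases "v = 0 \<or> w = 0")
        case False
        then have "\<rho> g v \<bullet> \<rho> g w = norm v * norm w * (sgn v \<bullet> sgn w)"
          using inner[OF g sgn_unit sgn_unit, of v w] by (simp add: \<rho>_def)
        also have "\<dots> = (norm v *\<^sub>R sgn v) \<bullet> (norm w *\<^sub>R sgn w)"
          by simp
        finally show ?thesis
          by (simp only: scale_sgn)
      qed (auto simp: \<rho>_def)
    qed
  next
    fix g h v
    assume g: "g \<in> carrier G" "h \<in> carrier G"
    show "\<rho> (g \<otimes>\<^bsub>G\<^esub> h) v = \<rho> g (\<rho> h v)"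
    proof (cases "v = 0")
      case False
      then show ?thesis
        using sgn_\<rho>[OF g(2) False] norm_\<rho>[OF g(2), of v] composition_rule[OF _ g, of "sgn v"] sgn_unit[OF False]
        by (simp add: \<rho>_def[of _ "\<rho> h v"]) (simp add: \<rho>_def)
    qed (simp add: \<rho>_def)
  next
    fix v
    show "\<rho> \<one>\<^bsub>G\<^esub> v = v"
    proof (cases "v = 0")
      case False
      then have "\<phi> \<one>\<^bsub>G\<^esub> (sgn v) = sgn v"
        using id_eq_one sgn_unit[OF False] by (metis mem_sphere_0 restrict_apply')
      then show ?thesis
        by (simp add: \<rho>_def scale_sgn)
    qed (simp add: \<rho>_def)
  next
    fix v :: 'a
    assume v: "v \<noteq> 0"
    have stab: "stabilizer G \<phi> (sgn v) = {\<one>\<^bsub>G\<^esub>}"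
      using free sgn_unit[OF v] by (simp add: free_action_def)
    have "sgn v \<in> topspace (top_of_set ?S)"
      using sgn_unit[OF v] by simp
    then obtain U where U: "neighborhood (top_of_set ?S) (sgn v) U"
      and disj: "\<And>g. g \<in> carrier G - stabilizer G \<phi> (sgn v) \<Longrightarrow> \<phi> g ` U \<inter> U = {}"
      using pd unfolding properly_discontinuous_action_def by meson
    obtain \<epsilon> where \<epsilon>: "0 < \<epsilon>" "\<And>y. norm y = 1 \<Longrightarrow> dist y (sgn v) < \<epsilon> \<Longrightarrow> y \<in> U"
      by (rule neighborhood_sphere_ball[OF U]) (rule that)
    have "norm v * \<epsilon> \<le> dist (\<rho> g v) v" if g: "g \<in> carrier G - {\<one>\<^bsub>G\<^esub>}" for g
    proof -
      have "\<phi> g (sgn v) \<notin> U"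
        using disj[of g] g stab neighborhood_mem[OF U] by blast
      then have "\<epsilon> \<le> dist (\<phi> g (sgn v)) (sgn v)"
        using \<epsilon>(2) unit[of g "sgn v"] g sgn_unit[OF v] by fastforce
      then show ?thesis
        using dist_scale[of g v "sgn v"] by (simp add: scale_sgn mult_left_mono)
    qed
    then show "\<exists>\<delta>>0. \<forall>g \<in> carrier G - {\<one>\<^bsub>G\<^esub>}. \<delta> \<le> dist (\<rho> g v) v"
      using v \<epsilon>(1) by (intro exI[of _ "norm v * \<epsilon>"]) auto
  next
    fix v w :: 'a
    assume nin: "\<And>g. g \<in> carrier G \<Longrightarrow> \<rho> g v \<noteq> w"
    show "\<exists>\<delta>>0. \<forall>g \<in> carrier G. \<delta> \<le> dist (\<rho> g v) w"
    proof (cases "norm v = norm w")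
      case False
      have "\<bar>norm v - norm w\<bar> \<le> dist (\<rho> g v) w" if "g \<in> carrier G" for g
        using norm_triangle_ineq3[of "\<rho> g v" w] norm_\<rho>[OF that, of v] by (simp add: dist_norm)
      then show ?thesis
        using False by (intro exI[of _ "\<bar>norm v - norm w\<bar>"]) auto
    next
      case True
      have v: "v \<noteq> 0"
        using nin[OF one_closed] True by (auto simp: \<rho>_def)
      with True have w: "w \<noteq> 0" by auto
      have "sgn w \<notin> orbit G \<phi> (sgn v)"
      proof
        assume "sgn w \<in> orbit G \<phi> (sgn v)"
        then obtain g where "g \<in> carrier G" "\<phi> g (sgn v) = sgn w"
          by (auto simp: orbit_def)
        then show False
          using nin[of g] True by (simp add: \<rho>_def scale_sgn)
      qed
      moreover have "sgn v \<in> topspace (top_of_set ?S)" "sgn w \<in> topspace (top_of_set ?S)"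
        using sgn_unit[OF v] sgn_unit[OF w] by simp_all
      ultimately obtain U V where U: "neighborhood (top_of_set ?S) (sgn v) U"
        and V: "neighborhood (top_of_set ?S) (sgn w) V"
        and disj: "\<And>g. g \<in> carrier G \<Longrightarrow> \<phi> g ` U \<inter> V = {}"
        using pd unfolding properly_discontinuous_action_def by meson
      obtain \<epsilon> where \<epsilon>: "0 < \<epsilon>" "\<And>y. norm y = 1 \<Longrightarrow> dist y (sgn w) < \<epsilon> \<Longrightarrow> y \<in> V"
        by (rule neighborhood_sphere_ball[OF V]) (rule that)
      have "norm v * \<epsilon> \<le> dist (\<rho> g v) w" if g: "g \<in> carrier G" for g
      proof -
        have "\<phi> g (sgn v) \<notin> V"
          using disj[OF g] neighborhood_mem[OF U] by blast
        then have "\<epsilon> \<le> dist (\<phi> g (sgn v)) (sgn w)"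
          using \<epsilon>(2) unit[of g "sgn v"] g sgn_unit[OF v] by fastforce
        then show ?thesis
          using dist_scale[of g v "sgn w"] True by (simp add: scale_sgn mult_left_mono)
      qed
      then show ?thesis
        using v \<epsilon>(1) by (intro exI[of _ "norm v * \<epsilon>"]) auto
    qed
  qed
  then show ?thesis by blast
qed

text \<open>
  If an orbit keeps distance \<open>\<delta>\<close> from a point, then balls of radius \<open>\<delta> / 2\<close> are the neighbourhoods
  required for proper discontinuity, because the group acts by isometries. The Riemannian distance is
  invariant because neither \<open>\<rho> g\<close> nor its inverse \<open>\<rho> (inv g)\<close> increases it.
\<close>
lemma (in free_discrete_orthogonal_rep) acts_on_sphere:
  "acts_freely_isometrically_prop_disc G (sphere (0 :: 'a) 1)"
proof -
  let ?S = "sphere (0 :: 'a) 1"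
  define \<phi> where "\<phi> g = restrict (\<rho> g) ?S" for g
  have \<phi>: "\<phi> g x = \<rho> g x" if "norm x = 1" for g x
    using that by (simp add: \<phi>_def)
  have stab: "stabilizer G \<phi> x = {\<one>}" if x: "norm x = 1" for x
  proof -
    have "x \<noteq> 0" using x by auto
    then show ?thesis
      using moves_nonzero[of x] by (auto simp: stabilizer_def \<phi>[OF x] one)
  qed
  have Bij: "\<phi> g \<in> Bij ?S" if "g \<in> carrier G" for g
  proof -
    have "bij_betw (\<rho> g) ?S ?S"
      by (rule bij_betw_byWitness[where f' = "\<rho> (inv g)"]) (use that in auto)
    then show ?thesis
      by (simp add: Bij_def \<phi>_def)
  qed
  have "\<phi> \<in> hom G (BijGroup ?S)"
  proof (rule homI)
    fix g h
    assume g: "g \<in> carrier G" "h \<in> carrier G"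
    show "\<phi> (g \<otimes> h) = \<phi> g \<otimes>\<^bsub>BijGroup ?S\<^esub> \<phi> h"
      using Bij g by (auto simp: BijGroup_def compose_def \<phi>_def mult fun_eq_iff restrict_def)
  qed (simp add: BijGroup_def Bij)
  then have "group_action G ?S \<phi>"
    unfolding group_action_def group_hom_def group_hom_axioms_def
    using group_BijGroup by (auto simp: is_group)
  moreover have "free_action G ?S \<phi>"
    by (simp add: free_action_def stab)
  moreover have "isometric_action G ?S \<phi>"
    unfolding isometric_action_def
  proof (intro ballI)
    fix g x y
    assume g: "g \<in> carrier G" and xy: "x \<in> ?S" "y \<in> ?S"
    have le: "riemannian_dist ?S (\<rho> h u) (\<rho> h v) \<le> riemannian_dist ?S u v" if "h \<in> carrier G" for h u v
      by (rule riemannian_dist_image_le) (use linear_rep that in auto)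
    show "riemannian_dist ?S (\<phi> g x) (\<phi> g y) = riemannian_dist ?S x y"
      using le[OF g, of x y] le[OF inv_closed[OF g], of "\<rho> g x" "\<rho> g y"] g xy by (simp add: \<phi>)
  qed
  moreover have "properly_discontinuous_action G (top_of_set ?S) \<phi>"
    unfolding properly_discontinuous_action_def
  proof (intro conjI ballI impI)
    fix x y
    assume "x \<in> topspace (top_of_set ?S)" "y \<in> topspace (top_of_set ?S)" and nin: "y \<notin> orbit G \<phi> x"
    then have x: "norm x = 1" and y: "norm y = 1" by auto
    have "\<rho> g x \<noteq> y" if "g \<in> carrier G" for g
      using that nin by (auto simp: orbit_def \<phi>[OF x])
    from separation[OF this] obtain \<delta> where \<delta>: "0 < \<delta>" "\<And>g. g \<in> carrier G \<Longrightarrow> \<delta> \<le> dist (\<rho> g x) y"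
      by auto
    have "\<phi> g ` (?S \<inter> ball x (\<delta> / 2)) \<inter> (?S \<inter> ball y (\<delta> / 2)) = {}" if g: "g \<in> carrier G" for g
    proof (rule equals0I)
      fix w
      assume "w \<in> \<phi> g ` (?S \<inter> ball x (\<delta> / 2)) \<inter> (?S \<inter> ball y (\<delta> / 2))"
      then obtain u where u: "norm u = 1" "dist x u < \<delta> / 2" "dist y (\<phi> g u) < \<delta> / 2"
        by auto
      then show False
        using \<delta>(2)[OF g] dist_triangle3[of "\<rho> g x" y "\<rho> g u"] dist_rep[OF g, of x u] \<phi>[OF u(1), of g]
        by (simp add: dist_commute)
    qed
    with ball_neighborhood_sphere[OF x half_gt_zero[OF \<delta>(1)]] ball_neighborhood_sphere[OF y half_gt_zero[OF \<delta>(1)]]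
    show "\<exists>U V. neighborhood (top_of_set ?S) x U \<and> neighborhood (top_of_set ?S) y V \<and>
        (\<forall>g\<in>carrier G. \<phi> g ` U \<inter> V = {})"
      by blast
  next
    fix x
    assume "x \<in> topspace (top_of_set ?S)"
    then have x: "norm x = 1" by auto
    then show "finite (stabilizer G \<phi> x)"
      by (simp add: stab)
    from x have "x \<noteq> 0" by auto
    then obtain \<delta> where \<delta>: "0 < \<delta>" "\<And>g. g \<in> carrier G - {\<one>} \<Longrightarrow> \<delta> \<le> dist (\<rho> g x) x"
      using displacement by blast
    have "\<phi> g ` (?S \<inter> ball x (\<delta> / 2)) \<inter> (?S \<inter> ball x (\<delta> / 2)) = {}" if g: "g \<in> carrier G - {\<one>}" for g
    proof (rule equals0I)
      fix w
      assume "w \<in> \<phi> g ` (?S \<inter> ball x (\<delta> / 2)) \<inter> (?S \<inter> ball x (\<delta> / 2))"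
      then obtain u where u: "norm u = 1" "dist x u < \<delta> / 2" "dist x (\<phi> g u) < \<delta> / 2"
        by auto
      then show False
        using \<delta>(2)[OF g] dist_triangle3[of "\<rho> g x" x "\<rho> g u"] dist_rep[of g x u] g u \<phi>[OF u(1), of g]
        by (simp add: dist_commute)
    qed
    moreover have "\<phi> \<one> ` (?S \<inter> ball x (\<delta> / 2)) = ?S \<inter> ball x (\<delta> / 2)"
      by (auto simp: \<phi> one image_iff)
    moreover note ball_neighborhood_sphere[OF x half_gt_zero[OF \<delta>(1)]]
    ultimately show "\<exists>U. neighborhood (top_of_set ?S) x U \<and> (\<forall>g\<in>stabilizer G \<phi> x. \<phi> g ` U = U) \<and>
        (\<forall>g\<in>carrier G - stabilizer G \<phi> x. \<phi> g ` U \<inter> U = {})"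
      unfolding stab[OF x] by blast
  qed
  ultimately show ?thesis
    unfolding acts_freely_isometrically_prop_disc_def by blast
qed

section \<open>Hilbert sums and diagonal representations\<close>

text \<open>
  The maps \<open>P i\<close> are the coordinate projections of an identification of \<open>'h\<close> with the Hilbert space sum
  of copies of \<open>'k\<close> indexed by \<open>I\<close>. For \<open>'k = real\<close> these are the coordinates with respect to an
  orthonormal basis.
\<close>
locale hilbert_sum =
  fixes I :: "'i set" and P :: "'i \<Rightarrow> 'h :: real_inner \<Rightarrow> 'k :: real_inner"
  assumes linear: "i \<in> I \<Longrightarrow> linear (P i)"
    and norm_sq: "((\<lambda>i. (norm (P i x))\<^sup>2) has_sum (norm x)\<^sup>2) I"
    and surj: "(\<lambda>i. (norm (v i))\<^sup>2) summable_on I \<Longrightarrow> \<exists>x. \<forall>i \<in> I. P i x = v i"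
begin

lemma norm_le: 
  assumes "i \<in> I" 
  shows "norm (P i x) \<le> norm x"
proof -
  have "(\<Sum>j\<in>{i}. (norm (P j x))\<^sup>2) \<le> (norm x)\<^sup>2"
    by (rule finite_sum_le_has_sum[OF norm_sq]) (use assms in auto)
  then show ?thesis
    by (simp add: power2_le_iff_abs_le)
qed

lemma eqI:
  assumes "\<And>i. i \<in> I \<Longrightarrow> P i x = P i y"
  shows "x = y"
proof -
  have "((\<lambda>i. (norm (P i (x - y)))\<^sup>2) has_sum 0) I"
    by (rule has_sum_0) (simp add: linear_diff[OF linear] assms)
  then have "(norm (x - y))\<^sup>2 = 0"
    using norm_sq has_sum_unique by blast
  then show ?thesis by simp
qed

text \<open>
  The group acts by \<open>\<rho>\<close> in every coordinate. A nonzero \<open>x\<close> has a nonzero coordinate \<open>P i x\<close>, and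
  projections do not increase distances, so \<open>x\<close> is moved at least as far as \<open>P i x\<close>. The orbit of \<open>x\<close>
  stays away from \<open>y\<close> if the orbit of \<open>P i x\<close> stays away from \<open>P i y\<close>. Otherwise \<open>P i y = \<rho> h (P i x)\<close>
  for some \<open>h\<close>: all other group elements keep \<open>P i x\<close> away from \<open>P i y\<close>, and the single point
  \<open>\<sigma> h x\<close> differs from \<open>y\<close>.
\<close>
lemma free_discrete_orthogonal_rep_sum:
  fixes \<rho> :: "'g \<Rightarrow> 'k \<Rightarrow> 'k"
  assumes "free_discrete_orthogonal_rep G \<rho>"
  shows "\<exists>\<sigma> :: 'g \<Rightarrow> 'h \<Rightarrow> 'h. free_discrete_orthogonal_rep G \<sigma>"
proof -
  interpret rep: free_discrete_orthogonal_rep G \<rho> by fact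
  define \<sigma> where "\<sigma> g x = (SOME y. \<forall>i \<in> I. P i y = \<rho> g (P i x))" for g x
  have P: "P i (\<sigma> g x) = \<rho> g (P i x)" if "i \<in> I" "g \<in> carrier G" for i g x
  proof -
    have "(\<lambda>i. (norm (\<rho> g (P i x)))\<^sup>2) summable_on I"
      using norm_sq[of x] that by (auto simp: summable_on_def)
    then have "\<exists>y. \<forall>i \<in> I. P i y = \<rho> g (P i x)"
      by (rule surj)
    from someI_ex[OF this] show ?thesis
      using that by (simp add: \<sigma>_def)
  qed
  have dist_P: "dist (P i x) (P i y) \<le> dist x y" if "i \<in> I" for i x y
    using norm_le[OF that, of "x - y"] by (simp add: dist_norm linear_diff[OF linear[OF that]])
  have nonzero: "\<exists>i \<in> I. P i x \<noteq> 0" if "x \<noteq> 0" for x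
    using eqI[of x 0] that by (auto simp: linear_0[OF linear])
  have norm_\<sigma>: "norm (\<sigma> g x) = norm x" if g: "g \<in> carrier G" for g x
  proof -
    have "((\<lambda>i. (norm (P i x))\<^sup>2) has_sum (norm (\<sigma> g x))\<^sup>2) I"
      using norm_sq[of "\<sigma> g x"] by (rule has_sum_cong[THEN iffD1, rotated]) (simp add: P g)
    from has_sum_unique[OF this norm_sq] show ?thesis
      by simp
  qed
  have "free_discrete_orthogonal_rep G \<sigma>"
  proof
    fix g
    assume g: "g \<in> carrier G"
    have "linear (\<sigma> g)"
      by (rule linearI; rule eqI)
        (simp_all add: P g linear_add[OF linear] linear_scale[OF linear]
          linear_add[OF rep.linear_rep] linear_scale[OF rep.linear_rep])
    then show "orthogonal_transformation (\<sigma> g)"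
      by (simp add: orthogonal_transformation norm_\<sigma> g)
  next
    fix g h x
    assume "g \<in> carrier G" "h \<in> carrier G"
    then show "\<sigma> (g \<otimes>\<^bsub>G\<^esub> h) x = \<sigma> g (\<sigma> h x)"
      by (intro eqI) (simp add: P rep.mult)
  next
    fix x
    show "\<sigma> \<one>\<^bsub>G\<^esub> x = x"
      by (intro eqI) (simp add: P rep.one)
  next
    fix x :: 'h
    assume "x \<noteq> 0"
    then obtain i where i: "i \<in> I" "P i x \<noteq> 0"
      using nonzero by blast
    from rep.displacement[OF i(2)] obtain \<delta> where \<delta>: "\<delta> > 0"
      "\<And>g. g \<in> carrier G - {\<one>\<^bsub>G\<^esub>} \<Longrightarrow> \<delta> \<le> dist (\<rho> g (P i x)) (P i x)"
      by auto
    have "\<delta> \<le> dist (\<sigma> g x) x" if "g \<in> carrier G - {\<one>\<^bsub>G\<^esub>}" for g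
      using \<delta>(2)[OF that] dist_P[OF i(1), of "\<sigma> g x" x] that i by (simp add: P)
    with \<delta>(1) show "\<exists>\<delta>>0. \<forall>g \<in> carrier G - {\<one>\<^bsub>G\<^esub>}. \<delta> \<le> dist (\<sigma> g x) x"
      by blast
  next
    fix x y
    assume nin: "\<And>g. g \<in> carrier G \<Longrightarrow> \<sigma> g x \<noteq> y"
    show "\<exists>\<delta>>0. \<forall>g \<in> carrier G. \<delta> \<le> dist (\<sigma> g x) y"
    proof (cases "x = 0")
      case True
      then have "\<sigma> g x = 0" if "g \<in> carrier G" for g
        using norm_\<sigma>[OF that, of x] by simp
      then show ?thesis
        using nin[OF rep.one_closed] by (intro exI[of _ "norm y"]) auto
    next
      case False
      then obtain i where i: "i \<in> I" "P i x \<noteq> 0"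
        using nonzero by blast
      have dist_ge: "dist (\<rho> g (P i x)) (P i y) \<le> dist (\<sigma> g x) y" if "g \<in> carrier G" for g
        using dist_P[OF i(1), of "\<sigma> g x" y] that i by (simp add: P)
      show ?thesis
      proof (cases "\<exists>g \<in> carrier G. \<rho> g (P i x) = P i y")
        case False
        then have "\<exists>\<delta>>0. \<forall>g \<in> carrier G. \<delta> \<le> dist (\<rho> g (P i x)) (P i y)"
          by (intro rep.separation) auto
        then show ?thesis
          using dist_ge by (meson order_trans)
      next
        case True
        then obtain h where h: "h \<in> carrier G" "\<rho> h (P i x) = P i y"
          by blast
        from rep.displacement[OF i(2)] obtain \<delta> where \<delta>: "\<delta> > 0"
          "\<And>g. g \<in> carrier G - {\<one>\<^bsub>G\<^esub>} \<Longrightarrow> \<delta> \<le> dist (\<rho> g (P i x)) (P i x)"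
          by auto
        have "min \<delta> (dist (\<sigma> h x) y) \<le> dist (\<sigma> g x) y" if g: "g \<in> carrier G" for g
        proof (cases "g = h")
          case False
          then have "inv\<^bsub>G\<^esub> h \<otimes>\<^bsub>G\<^esub> g \<in> carrier G - {\<one>\<^bsub>G\<^esub>}"
            using g h by (metis Diff_iff rep.inv_closed rep.inv_equality rep.inv_inv rep.m_closed singletonD)
          from \<delta>(2)[OF this] have "\<delta> \<le> dist (\<rho> (inv\<^bsub>G\<^esub> h) (\<rho> g (P i x))) (P i x)"
            using g h by (simp add: rep.mult)
          also have "\<dots> = dist (\<rho> h (\<rho> (inv\<^bsub>G\<^esub> h) (\<rho> g (P i x)))) (\<rho> h (P i x))"
            by (rule rep.dist_rep[OF h(1), symmetric])
          also have "\<dots> \<le> dist (\<sigma> g x) y"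
            using dist_ge[OF g] h by simp
          finally show ?thesis by simp
        qed simp
        moreover have "min \<delta> (dist (\<sigma> h x) y) > 0"
          using \<delta>(1) nin[OF h(1)] by simp
        ultimately show ?thesis
          by blast
      qed
    qed
  qed
  then show ?thesis by blast
qed

end

section \<open>Orthonormal bases\<close>

definition orthonormal :: "'a :: real_inner set \<Rightarrow> bool" where
  "orthonormal B \<longleftrightarrow> (\<forall>b \<in> B. norm b = 1) \<and> pairwise orthogonal B"

lemma orthonormal_inner:
  "orthonormal B \<Longrightarrow> b \<in> B \<Longrightarrow> c \<in> B \<Longrightarrow> b \<bullet> c = (if b = c then 1 else 0)"
  by (auto simp: orthonormal_def pairwise_def orthogonal_def norm_eq_1)

lemma orthonormal_norm_sum:
  assumes "orthonormal B" "finite F" "F \<subseteq> B"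
  shows "(norm (\<Sum>b\<in>F. c b *\<^sub>R b))\<^sup>2 = (\<Sum>b\<in>F. (c b)\<^sup>2)"
proof -
  have "(norm (\<Sum>b\<in>F. c b *\<^sub>R b))\<^sup>2 = (\<Sum>b\<in>F. (norm (c b *\<^sub>R b))\<^sup>2)"
    using assms by (intro norm_sum_Pythagorean)
      (auto simp: orthonormal_def pairwise_def orthogonal_def subset_iff)
  also have "\<dots> = (\<Sum>b\<in>F. (c b)\<^sup>2)"
    using assms by (intro sum.cong) (auto simp: orthonormal_def subset_iff)
  finally show ?thesis .
qed

lemma orthonormal_Bessel:
  assumes "orthonormal B" "finite F" "F \<subseteq> B"
  shows "(\<Sum>b\<in>F. (b \<bullet> x)\<^sup>2) \<le> (norm x)\<^sup>2"
proof -
  define s where "s = (\<Sum>b\<in>F. (b \<bullet> x) *\<^sub>R b)"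
  have "s \<bullet> s = (\<Sum>b\<in>F. (b \<bullet> x)\<^sup>2)"
    using orthonormal_norm_sum[OF assms, of "\<lambda>b. b \<bullet> x"] by (simp add: s_def power2_norm_eq_inner)
  moreover have "s \<bullet> x = (\<Sum>b\<in>F. (b \<bullet> x)\<^sup>2)"
    by (simp add: s_def inner_sum_left power2_eq_square)
  moreover have "0 \<le> (x - s) \<bullet> (x - s)"
    by simp
  ultimately show ?thesis
    by (simp add: inner_diff_left inner_diff_right inner_commute power2_norm_eq_inner)
qed

text \<open>
  The Riesz-Fischer theorem. By Pythagoras, finite partial sums that contain a common finite set \<open>F\<close>
  differ by at most twice the square root of the tail of \<open>\<Sum>b. (c b)\<^sup>2\<close> outside \<open>F\<close>, so they form a
  Cauchy filter.
\<close>
lemma orthonormal_series_has_sum: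
  fixes B :: "'a :: {real_inner, complete_space} set"
  assumes B: "orthonormal B" and c: "(\<lambda>b. (c b)\<^sup>2) summable_on B"
  shows "\<exists>y. ((\<lambda>b. c b *\<^sub>R b) has_sum y) B"
proof -
  let ?s = "\<lambda>F. \<Sum>b\<in>F. c b *\<^sub>R b"
  obtain T where T: "((\<lambda>b. (c b)\<^sup>2) has_sum T) B"
    using c by (auto simp: summable_on_def)
  have "cauchy_filter (filtermap ?s (finite_subsets_at_top B))"
    unfolding cauchy_filter_metric_filtermap
  proof (intro allI impI)
    fix e :: real
    assume e: "0 < e"
    obtain F where F: "finite F" "F \<subseteq> B" "dist (\<Sum>b\<in>F. (c b)\<^sup>2) T \<le> (e / 3)\<^sup>2"
      using has_sum_finite_approximation[OF T, of "(e / 3)\<^sup>2"] e by auto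
    have near: "dist (?s F') (?s F) \<le> e / 3" if F': "finite F'" "F \<subseteq> F'" "F' \<subseteq> B" for F'
    proof -
      have "(norm (?s F' - ?s F))\<^sup>2 = (\<Sum>b\<in>F' - F. (c b)\<^sup>2)"
        using orthonormal_norm_sum[OF B, of "F' - F" c] F' by (simp add: sum_diff subset_iff)
      also have "\<dots> = (\<Sum>b\<in>F'. (c b)\<^sup>2) - (\<Sum>b\<in>F. (c b)\<^sup>2)"
        using F' by (simp add: sum_diff)
      also have "\<dots> \<le> T - (\<Sum>b\<in>F. (c b)\<^sup>2)"
        using finite_sum_le_has_sum[OF T F'(1,3)] by simp
      also have "\<dots> \<le> (e / 3)\<^sup>2"
        using F(3) by (simp add: dist_real_def)
      finally show ?thesis
        using e by (simp add: dist_norm power2_le_iff_abs_le)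
    qed
    have "\<forall>\<^sub>F F' in finite_subsets_at_top B. finite F' \<and> F \<subseteq> F' \<and> F' \<subseteq> B"
      using F by (auto simp: eventually_finite_subsets_at_top)
    moreover have "dist (?s F') (?s F'') < e"
      if "finite F' \<and> F \<subseteq> F' \<and> F' \<subseteq> B" "finite F'' \<and> F \<subseteq> F'' \<and> F'' \<subseteq> B" for F' F''
      using dist_triangle2[of "?s F'" "?s F''" "?s F"] near[of F'] near[of F''] that e by simp
    ultimately show "\<exists>P. eventually P (finite_subsets_at_top B) \<and>
        (\<forall>x y. P x \<and> P y \<longrightarrow> dist (?s x) (?s y) < e)"
      by (intro exI[of _ "\<lambda>F'. finite F' \<and> F \<subseteq> F' \<and> F' \<subseteq> B"]) blast
  qed
  then have "convergent_filter (filtermap ?s (finite_subsets_at_top B))"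
    by (rule cauchy_filter_convergent)
  then show ?thesis
    by (simp add: convergent_filter_iff has_sum_def filterlim_def)
qed

lemma orthonormal_series_coordinate:
  assumes B: "orthonormal B" and y: "((\<lambda>b. c b *\<^sub>R b) has_sum y) B" and b: "b \<in> B"
  shows "b \<bullet> y = c b"
proof -
  have "((\<lambda>a. b \<bullet> (c a *\<^sub>R a)) has_sum b \<bullet> y) B"
    using bounded_linear_inner_right y by (rule has_sum_bounded_linear)
  moreover have "((\<lambda>a. b \<bullet> (c a *\<^sub>R a)) has_sum c b) B"
    by (rule has_sum_finite_neutralI[of "{b}"]) (use b orthonormal_inner[OF B b] in auto)
  ultimately show ?thesis
    by (rule has_sum_unique)
qed

text \<open>
  By Zorn's lemma there is a maximal orthonormal set. A nonzero vector orthogonal to it could be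
  normalized and added.
\<close>
lemma maximal_orthonormal_exists:
  "\<exists>B :: 'a :: real_inner set. orthonormal B \<and> (\<forall>x. (\<forall>b \<in> B. b \<bullet> x = 0) \<longrightarrow> x = 0)"
proof -
  have "\<exists>B\<in>{B :: 'a set. orthonormal B}. \<forall>X\<in>{B. orthonormal B}. B \<subseteq> X \<longrightarrow> X = B"
  proof (rule subset_Zorn')
    fix C :: "'a set set"
    assume C: "subset.chain {B. orthonormal B} C"
    then have "b \<bullet> c = 0" if "b \<in> \<Union>C" "c \<in> \<Union>C" "b \<noteq> c" for b c
    proof -
      from that obtain X Y where "X \<in> C" "Y \<in> C" "b \<in> X" "c \<in> Y" by blast
      moreover from this C have "X \<subseteq> Y \<or> Y \<subseteq> X" "orthonormal X" "orthonormal Y"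
        unfolding subset_chain_def by blast+
      ultimately show ?thesis
        using orthonormal_inner that(3) by (metis subsetD)
    qed
    moreover have "norm b = 1" if "b \<in> \<Union>C" for b
      using that C unfolding subset_chain_def orthonormal_def by blast
    ultimately show "\<Union>C \<in> {B. orthonormal B}"
      by (simp add: orthonormal_def pairwise_def orthogonal_def)
  qed
  then obtain B :: "'a set" where B: "orthonormal B"
    and max: "\<And>X. orthonormal X \<Longrightarrow> B \<subseteq> X \<Longrightarrow> X = B"
    by blast
  have "x = 0" if x: "\<And>b. b \<in> B \<Longrightarrow> b \<bullet> x = 0" for x
  proof (rule ccontr)
    assume "x \<noteq> 0"
    then have unit: "norm (sgn x) = 1"
      by (simp add: norm_sgn)
    have "b \<bullet> sgn x = 0" if "b \<in> B" for b
      using x[OF that] by (simp add: sgn_div_norm)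
    then have "orthonormal (insert (sgn x) B)"
      using B unit by (auto simp: orthonormal_def pairwise_insert orthogonal_def inner_commute)
    then have "sgn x \<in> B"
      using max by blast
    with \<open>\<And>b. b \<in> B \<Longrightarrow> b \<bullet> sgn x = 0\<close> unit show False
      by (metis norm_eq_1 zero_neq_one)
  qed
  with B show ?thesis
    by blast
qed

text \<open>
  For a maximal orthonormal set, the series \<open>\<Sum>b. (b \<bullet> x) b\<close> converges by Bessel's inequality, and its sum
  is \<open>x\<close> because the difference is orthogonal to the set. Pairing the series with \<open>x\<close> gives Parseval's identity.
\<close>
lemma orthonormal_basis_exists:
  obtains B :: "'h :: {real_inner, complete_space} set" where "hilbert_sum B (\<lambda>b x. b \<bullet> x)"
proof -
  obtain B :: "'h set" where B: "orthonormal B"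
    and total: "\<And>x. (\<And>b. b \<in> B \<Longrightarrow> b \<bullet> x = 0) \<Longrightarrow> x = 0"
    using maximal_orthonormal_exists by blast
  have "hilbert_sum B (\<lambda>b x. b \<bullet> x)"
  proof (rule hilbert_sum.intro)
    fix x
    have "(\<lambda>b. (b \<bullet> x)\<^sup>2) summable_on B"
      by (rule nonneg_bdd_above_summable_on)
        (auto intro!: bdd_aboveI2[where M = "(norm x)\<^sup>2"] orthonormal_Bessel[OF B])
    then obtain y where y: "((\<lambda>b. (b \<bullet> x) *\<^sub>R b) has_sum y) B"
      using orthonormal_series_has_sum[OF B, of "\<lambda>b. b \<bullet> x"] by blast
    have "y = x"
      using total[of "x - y"] orthonormal_series_coordinate[OF B y] by (simp add: inner_diff_right)
    then have "((\<lambda>b. x \<bullet> ((b \<bullet> x) *\<^sub>R b)) has_sum x \<bullet> x) B"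
      using has_sum_bounded_linear[OF bounded_linear_inner_right y, of x] by simp
    then show "((\<lambda>b. (norm (b \<bullet> x))\<^sup>2) has_sum (norm x)\<^sup>2) B"
      unfolding power2_norm_eq_inner by (simp add: inner_commute)
  next
    fix v :: "'h \<Rightarrow> real"
    assume "(\<lambda>b. (norm (v b))\<^sup>2) summable_on B"
    then obtain y where "((\<lambda>b. v b *\<^sub>R b) has_sum y) B"
      using orthonormal_series_has_sum[OF B, of v] by auto
    then show "\<exists>x. \<forall>b\<in>B. b \<bullet> x = v b"
      using orthonormal_series_coordinate[OF B] by blast
  qed (simp add: bounded_linear.linear bounded_linear_inner_right)
  then show ?thesis
    by (rule that)
qed

text \<open>
  The vectors \<open>e i\<close> whose only nonzero coordinate is the \<open>i\<close>-th, with value one, span the space.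
\<close>
lemma hilbert_sum_finite_spanning_set:
  fixes Q :: "'i \<Rightarrow> 'h :: real_inner \<Rightarrow> real"
  assumes "hilbert_sum I Q" and fin: "finite I"
  shows "\<exists>B :: 'h set. finite B \<and> span B = UNIV"
proof -
  interpret Q: hilbert_sum I Q by fact
  have "\<exists>x. \<forall>j\<in>I. Q j x = (if j = i then 1 else 0)" for i
    by (rule Q.surj) (simp add: fin)
  then obtain e where e: "\<And>i j. j \<in> I \<Longrightarrow> Q j (e i) = (if j = i then 1 else 0)"
    by metis
  have "x \<in> span (e ` I)" for x
  proof -
    have "x = (\<Sum>i\<in>I. Q i x *\<^sub>R e i)"
    proof (rule Q.eqI)
      fix j
      assume j: "j \<in> I"
      show "Q j x = Q j (\<Sum>i\<in>I. Q i x *\<^sub>R e i)"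
        using j fin by (simp add: linear_sum[OF Q.linear[OF j]] linear_scale[OF Q.linear[OF j]] e if_distrib sum.delta cong: if_cong)
    qed
    also have "\<dots> \<in> span (e ` I)"
      by (intro span_sum span_scale span_base imageI)
    finally show ?thesis .
  qed
  then show ?thesis
    using fin by (intro exI[of _ "e ` I"]) auto
qed

section \<open>Decomposing a Hilbert space into copies of a separable one\<close>

lemma hilbert_sum_vec: "hilbert_sum UNIV (\<lambda>i (x :: real ^ 'n). x $ i)"
proof (rule hilbert_sum.intro)
  fix x :: "real ^ 'n"
  have "(norm x)\<^sup>2 = (\<Sum>i\<in>UNIV. (norm (x $ i))\<^sup>2)"
    by (simp add: norm_vec_def L2_set_def sum_nonneg)
  then show "((\<lambda>i. (norm (x $ i))\<^sup>2) has_sum (norm x)\<^sup>2) UNIV"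
    by (intro has_sum_finiteI) auto
next
  fix v :: "'n \<Rightarrow> real"
  show "\<exists>x. \<forall>i\<in>UNIV. x $ i = v i"
    by (intro exI[of _ "vec_lambda v"]) simp
next
  fix i :: 'n
  show "linear (\<lambda>x :: real ^ 'n. x $ i)"
    by (rule linearI) simp_all
qed

lemma hilbert_sum_l2: "hilbert_sum UNIV (\<lambda>n x. l2_nth x n)"
proof (rule hilbert_sum.intro)
  fix x
  have "(\<lambda>n. (l2_nth x n)\<^sup>2) sums (norm x)\<^sup>2"
    using summable_l2_nth[of x] by (simp add: norm_l2_power2 summable_sums)
  then show "((\<lambda>n. (norm (l2_nth x n))\<^sup>2) has_sum (norm x)\<^sup>2) UNIV"
    by (intro norm_summable_imp_has_sum) (auto simp: summable_l2_nth)
next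
  fix v :: "nat \<Rightarrow> real"
  assume "(\<lambda>n. (norm (v n))\<^sup>2) summable_on UNIV"
  then have "summable (\<lambda>n. (v n)\<^sup>2)"
    using summable_on_imp_summable by fastforce
  then show "\<exists>x. \<forall>n\<in>UNIV. l2_nth x n = v n"
    by (intro exI[of _ "Abs_l2 v"]) (simp add: Abs_l2_inverse)
next
  fix n
  show "linear (\<lambda>x. l2_nth x n)"
    by (rule linearI) (simp_all add: plus_l2.rep_eq scaleR_l2.rep_eq)
qed

text \<open>
  Given real coordinates indexed by \<open>N\<close> on \<open>'k\<close> and by \<open>A \<times> N\<close> (through \<open>\<pi>\<close>) on \<open>'h\<close>, the coordinates
  of \<open>x\<close> with fixed first index \<open>a\<close> form a square-summable family, hence the coordinates of a vector
  \<open>P a x\<close> of \<open>'k\<close>. Summing squares first over \<open>N\<close> and then over \<open>A\<close> gives the norm identity.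
\<close>
lemma hilbert_sum_regroup:
  fixes Q :: "'n \<Rightarrow> 'k :: real_inner \<Rightarrow> real" and R :: "'b \<Rightarrow> 'h :: real_inner \<Rightarrow> real"
  assumes "hilbert_sum N Q" and "hilbert_sum B R" and \<pi>: "bij_betw \<pi> (A \<times> N) B"
  shows "\<exists>P :: 'a \<Rightarrow> 'h \<Rightarrow> 'k. hilbert_sum A P"
proof -
  interpret Q: hilbert_sum N Q by fact
  interpret R: hilbert_sum B R by fact
  define P where "P a x = (SOME v. \<forall>n \<in> N. Q n v = R (\<pi> (a, n)) x)" for a x
  have total: "((\<lambda>p. (R (\<pi> p) x)\<^sup>2) has_sum (norm x)\<^sup>2) (A \<times> N)" for x
    using R.norm_sq[of x] has_sum_reindex_bij_betw[OF \<pi>, of "\<lambda>b. (R b x)\<^sup>2"] by simp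
  have P: "Q n (P a x) = R (\<pi> (a, n)) x" if "a \<in> A" "n \<in> N" for a n x
  proof -
    have "(\<lambda>(a, n). (R (\<pi> (a, n)) x)\<^sup>2) summable_on A \<times> N"
      using total[of x] by (auto simp: summable_on_def case_prod_unfold)
    then have "(\<lambda>n. (R (\<pi> (a, n)) x)\<^sup>2) summable_on N"
      by (rule summable_on_SigmaD1) (rule that)
    then have "\<exists>v. \<forall>n \<in> N. Q n v = R (\<pi> (a, n)) x"
      by (intro Q.surj) simp
    from someI_ex[OF this] show ?thesis
      using that by (simp add: P_def)
  qed
  have \<pi>_B: "\<pi> (a, n) \<in> B" if "a \<in> A" "n \<in> N" for a n
    using that bij_betwE[OF \<pi>] by blast
  have "hilbert_sum A P"
  proof (rule hilbert_sum.intro)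
    fix a
    assume a: "a \<in> A"
    show "linear (P a)"
      by (rule linearI; rule Q.eqI)
        (simp_all add: P a \<pi>_B linear_add[OF Q.linear] linear_scale[OF Q.linear]
          linear_add[OF R.linear] linear_scale[OF R.linear])
  next
    fix x
    show "((\<lambda>a. (norm (P a x))\<^sup>2) has_sum (norm x)\<^sup>2) A"
    proof (rule has_sum_SigmaD[OF total])
      fix a
      assume a: "a \<in> A"
      show "((\<lambda>n. (R (\<pi> (a, n)) x)\<^sup>2) has_sum (norm (P a x))\<^sup>2) N"
        using Q.norm_sq[of "P a x"] by (rule has_sum_cong[THEN iffD1, rotated]) (simp add: P a)
    qed
  next
    fix v :: "'a \<Rightarrow> 'k"
    assume v: "(\<lambda>a. (norm (v a))\<^sup>2) summable_on A"
    define \<pi>' where "\<pi>' = inv_into (A \<times> N) \<pi>"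
    \<comment> \<open>\<open>w\<close> lists the real coordinates of all the prescribed vectors \<open>v a\<close> in one family.\<close>
    define w where "w b = Q (snd (\<pi>' b)) (v (fst (\<pi>' b)))" for b
    have w: "w (\<pi> (a, n)) = Q n (v a)" if "a \<in> A" "n \<in> N" for a n
      using that \<pi> by (simp add: w_def \<pi>'_def bij_betw_inv_into_left)
    have "(\<lambda>p. (w (\<pi> p))\<^sup>2) summable_on A \<times> N"
    proof (rule summable_on_SigmaI[OF _ v])
      fix a
      assume a: "a \<in> A"
      show "((\<lambda>n. (w (\<pi> (a, n)))\<^sup>2) has_sum (norm (v a))\<^sup>2) N"
        using Q.norm_sq[of "v a"] by (rule has_sum_cong[THEN iffD1, rotated]) (simp add: w a)
    qed simp
    then have "(\<lambda>b. (norm (w b))\<^sup>2) summable_on B"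
      using summable_on_reindex_bij_betw[OF \<pi>, of "\<lambda>b. (w b)\<^sup>2"] by simp
    then obtain x where x: "\<And>b. b \<in> B \<Longrightarrow> R b x = w b"
      using R.surj by blast
    have "P a x = v a" if "a \<in> A" for a
      by (rule Q.eqI) (simp add: P that x \<pi>_B w)
    then show "\<exists>x. \<forall>a\<in>A. P a x = v a"
      by blast
  qed
  then show ?thesis by blast
qed

lemma infinite_times_countable_bij:
  assumes "infinite B" "countable N" "N \<noteq> {}"
  shows "\<exists>\<pi>. bij_betw \<pi> (B \<times> N) B"
proof -
  have "ordLeq3 (card_of N) (card_of (UNIV :: nat set))"
    using assms(2) unfolding countable_def card_of_ordLeq[symmetric] by blast
  moreover have "ordLeq3 (card_of (UNIV :: nat set)) (card_of B)"
    using assms(1) infinite_iff_card_of_nat by blast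
  ultimately have "ordLeq3 (card_of N) (card_of B)"
    by (rule ordLeq_transitive)
  then show ?thesis
    using card_of_Times_infinite[OF assms(1,3)] card_of_ordIso by blast
qed

section \<open>Transferring the action\<close>

text \<open>
  An orthonormal basis \<open>B\<close> of \<open>'h\<close> is infinite, so it is in bijection with \<open>B \<times> N\<close>. This exhibits \<open>'h\<close>
  as a Hilbert sum of copies of \<open>'k\<close>, on which the group acts diagonally.
\<close>
lemma sphere_action_transfer:
  fixes G :: "('g, 'm) monoid_scheme" and Q :: "'n \<Rightarrow> 'k :: real_inner \<Rightarrow> real"
  assumes "group G" and acts: "acts_freely_isometrically_prop_disc G (sphere (0 :: 'k) 1)"
    and Q: "hilbert_sum N Q" and N: "countable N" "N \<noteq> {}"
    and infinite_dim: "\<not> (\<exists>B :: 'h :: {real_inner, complete_space} set. finite B \<and> span B = UNIV)"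
  shows "acts_freely_isometrically_prop_disc G (sphere (0 :: 'h) 1)"
proof -
  obtain B :: "'h set" where B: "hilbert_sum B (\<lambda>b x. b \<bullet> x)"
    by (rule orthonormal_basis_exists)
  then have "infinite B"
    using hilbert_sum_finite_spanning_set infinite_dim by blast
  then obtain \<pi> where "bij_betw \<pi> (B \<times> N) B"
    using infinite_times_countable_bij N by blast
  then obtain P :: "'h \<Rightarrow> 'h \<Rightarrow> 'k" where P: "hilbert_sum B P"
    using hilbert_sum_regroup[OF Q B] by blast
  obtain \<rho> :: "'g \<Rightarrow> 'k \<Rightarrow> 'k" where "free_discrete_orthogonal_rep G \<rho>"
    using orthogonal_rep_of_sphere_action[OF \<open>group G\<close> acts] by blast
  then obtain \<sigma> :: "'g \<Rightarrow> 'h \<Rightarrow> 'h" where "free_discrete_orthogonal_rep G \<sigma>"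
    using hilbert_sum.free_discrete_orthogonal_rep_sum[OF P] by blast
  then show ?thesis
    by (rule free_discrete_orthogonal_rep.acts_on_sphere)
qed

theorem proposition4:
  fixes G :: "('g, 'm) monoid_scheme"
  assumes "group G"
    and "acts_freely_isometrically_prop_disc G (sphere (0 :: real ^ 'n) 1) \<or>
         acts_freely_isometrically_prop_disc G (sphere (0 :: l2) 1)"
    and infinite_dim: "\<not> (\<exists>B :: 'h :: {real_inner, complete_space} set. finite B \<and> span B = UNIV)"
  shows "acts_freely_isometrically_prop_disc G (sphere (0 :: 'h) 1)"
  using assms(2)
proof
  assume "acts_freely_isometrically_prop_disc G (sphere (0 :: real ^ 'n) 1)"
  then show ?thesis
    using hilbert_sum_vec by (rule sphere_action_transfer[OF \<open>group G\<close>])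
      (use infinite_dim in \<open>auto simp: countable_finite\<close>)
next
  assume "acts_freely_isometrically_prop_disc G (sphere (0 :: l2) 1)"
  then show ?thesis
    using hilbert_sum_l2 by (rule sphere_action_transfer[OF \<open>group G\<close>])
      (use infinite_dim in auto)
qed

end
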